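(* Consider a game with agent set $\mathcal N=\mathcal T\cup\mathcal A$ (truthful and adversarial agents, disjoint), cost functions $J_i$, communication graph $\mathcal G_c$ and observation graph $\mathcal G_o$, such that the following hold. (A1) $\Omega=\mathbb R^n$; for each $i\in\mathcal N$ and each $x_{-i}$, $J_i(x_i,x_{-i})$ is continuously differentiable, and convex and radially unbounded in $x_i$; the pseudo-gradient $F(x)=\mathrm{col}\left(\frac{\partial J_i(x)}{\partial x_i}\right)_{i\in\mathcal N}$ is $\mu$-strongly monotone and $L$-Lipschitz. (A2) In $\mathcal G_c$, every truthful agent has at most $D$ adversarial in-neighbours, and $|\mathcal N_i^{in}(\mathcal G_c)|\ge 2D+1$ for all $i\in\mathcal T$. (A3) Every adversarial agent forms its intermediate estimate $\mathbf v^i$ as a weighted average of messages of truthful agents only, and updates $\mathbf x^i$ by Step 3 of Algorithm 1 (both made precise in the context). (A4) Every node $m\in\mathcal N$ is $(2D+1)$-information robust. Let $C=1-\left(\frac{\eta}{2}\right)^{N-1}$, $\overline p=\frac{4N}{1-C^{2/(N-1)}}$, and $$M=\begin{bmatrix}2\alpha\mu-\overline p\alpha^2L^2 & -\alpha\overline pL(1+\alpha L)\\ -\alpha\overline pL(1+\alpha L) & 1-2\alpha(\overline p-1)L-\overline p\alpha^2L^2\end{bmatrix},$$ and select the step size $\alpha$ such that $M\succ 0$ (positive definite). Then for any initial condition, the iterates generated by Algorithm 1 satisfy $\mathrm{col}(\mathbf x^i[k])_{i\in\mathcal N}\to\mathbf 1_N\otimes x^*$ as $k\to\infty$, where $x^*$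 is the Nash equilibrium of the game.
   Context: Game. There are $N$ agents, $\mathcal N=\{1,\dots,N\}$. Agent $i$ has action $x_i\in\Omega_i\subset\mathbb R^{n_i}$ with components $x_{iq}$, $q\in\{1,\dots,n_i\}$; $n=\sum_i n_i$, $x=\mathrm{col}(x_i)_{i\in\mathcal N}\in\Omega=\prod_i\Omega_i$ (col means vertical stacking), $x=(x_i,x_{-i})$, and cost $J_i:\Omega\to\mathbb R$. A Nash equilibrium is a profile $x^*$ such that, for each $i$, $x_i^*$ minimizes $J_i(\cdot,x_{-i}^* )$ over $\Omega_i$; under (A1) it exists, is unique and is characterized by $F(x^* )=0$. Graphs. $\mathcal G_c=(\mathcal N,\mathcal E_c)$ and $\mathcal G_o=(\mathcal N,\mathcal E_o)$ are directed graphs; $e_{ij}$ denotes an edge from $j$ to $i$; $\mathcal N_i^{in}(\mathcal G)=\{j: e_{ij}\in\mathcal E\}$, $\mathcal N_i^{out}(\mathcal G)=\{j: e_{ji}\in\mathcal E\}$. If $e_{ij}\in\mathcal E_c$, agent $j$ sends messages to agent $i$; if $e_{ij}\in\mathcal E_o$, agent $i$ directly observes the true action $x_j$. By convention $e_{ii}\in\mathcal E_o$ for all $i$. A node $m$ is $r$-information robust if for every proper subset $S\subsetneq\mathcal N$ with $S\supset\mathcal N_m^{out}(\mathcal G_o)$ there is $j\in\mathcal N\setminus S$ with $|\mathcal N_j^{in}(\mathcal G_c)\cap S|\ge r$. Estimates and messages. Agent $i$ keeps $\mathbf x^i=\mathrm{col}(\mathbf x^i_m)_{m\in\mathcal N}\in\mathbb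 R^n$, where $\mathbf x^i_m\in\mathbb R^{n_m}$ (components $\mathbf x^i_{mq}$) is its estimate of agent $m$'s action, and $\mathbf x^i_i=x_i$ is its actual action. $\mathbf y^{ij}=\mathrm{col}(\mathbf y^{ij}_m)_{m}\in\mathbb R^n$ (components $\mathbf y^{ij}_{mq}$) is the message sent by $j$ to $i$ over $\mathcal G_c$; $\mathbf y^{ii}=\mathbf x^i$. Truthful agents $j\in\mathcal T$ send $\mathbf y^{ij}[k]=\mathbf x^j[k]$ at every iteration $k$; messages sent by adversarial agents are arbitrary. $D$ is a nonnegative integer. Algorithm 1 (iteration $k$). Step 1: messages are exchanged over $\mathcal G_c$. Step 2: for each $m\in\mathcal N$ and $q\in\{1,\dots,n_m\}$, agent $i\in\mathcal T$ removes, among the received values $\mathbf y^{ij}_{mq}[k]$, $j\in\mathcal N_i^{in}(\mathcal G_c)$, the $D$ highest of those larger than its own value $\mathbf x^i_{mq}[k]$ and the $D$ smallest of those smaller than its own value (ties broken arbitrarily; if fewer than $D$ values are larger, resp. smaller, it removes all of those). $\mathcal Y^i_{mq}$ is the set consisting of $i$ and the agents whose value is retained. Then $\mathbf v^i_{mq}[k]=\sum_{j\in\mathcal Y^i_{mq}}w^{ij}_{mq}[k]\,\mathbf y^{ij}_{mq}[k]$ if $m\notin\mathcal N_i^{in}(\mathcal G_o)$, and $\mathbf v^i_{mq}[k]=x_{mq}[k]$ otherwise, where $\sum_{j}w^{ij}_{mq}[k]=1$, $w^{ij}_{mq}[k]=0$ for $j\notin\mathcal Y^i_{mq}$, and $w^{ij}_{mq}[k]\ge\eta$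 for $j\in\mathcal Y^i_{mq}$, with a fixed constant $\eta>0$. Step 3: $\mathbf x^i[k+1]=\mathbf v^i[k]-\alpha\mathcal R_i^T\frac{\partial J_i(\mathbf v^i[k])}{\partial x_i}$, where $\mathcal R_i=[\mathbf 0_{n_i\times n_i^<}\ I_{n_i}\ \mathbf 0_{n_i\times n_i^>}]$, $n_i^<=\sum_{j<i}n_j$, $n_i^>=\sum_{j>i}n_j$. Step 4: agents $i\in\mathcal T$ set $\mathbf y^{ji}[k+1]=\mathbf x^i[k+1]$. Adversarial agents (A3). For $i\in\mathcal A$: $\mathbf v^i_{mq}[k]=x_{mq}[k]$ if $m\in\mathcal N_i^{in}(\mathcal G_o)$; otherwise $\mathbf v^i_{mq}[k]=\sum_j\tilde w^{ij}_{mq}[k]\,\mathbf x^j_{mq}[k]$ with weights supported on $\mathcal N_i^{in}(\mathcal G_c)\cap\mathcal T$, summing to $1$ over $j$, and each nonzero weight at least $\eta$. Then $\mathbf x^i[k+1]$ is given by Step 3. *)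

theory Defs
  imports "HOL-Analysis.Analysis"
begin

text \<open>
  Agents are the elements of a finite type \<open>'a\<close>, so \<open>N = CARD('a)\<close>.  The \<open>n\<close> scalar
  coordinates of a joint action are the elements of a finite type \<open>'c\<close>, and
  \<open>own :: 'c \<Rightarrow> 'a\<close> maps a coordinate to the agent it belongs to: a pair \<open>(m, q)\<close> with
  \<open>q \<in> {1, \<dots>, n\<^sub>m}\<close> is a coordinate \<open>c\<close> with \<open>own c = m\<close>, and \<open>n\<^sub>m = card {c. own c = m}\<close>.
  Joint actions, estimates and messages are vectors in \<open>real ^ 'c\<close>.  An action of agent \<open>i\<close>
  alone is given by any vector in \<open>real ^ 'c\<close>, of which only the coordinates of \<open>i\<close> are read.
\<close>

section \<open>Games\<close>

definition block :: "('c \<Rightarrow> 'a) \<Rightarrow> 'a \<Rightarrow> real ^ 'c \<Rightarrow> real ^ 'c::finite" where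
  "block own i u = (\<chi> c. if own c = i then u $ c else 0)"

text \<open>The profile \<open>(u\<^sub>i, x\<^sub>-\<^sub>i)\<close>.\<close>

definition with_action :: "('c \<Rightarrow> 'a) \<Rightarrow> 'a \<Rightarrow> real ^ 'c \<Rightarrow> real ^ 'c \<Rightarrow> real ^ 'c::finite" where
  "with_action own i u x = (\<chi> c. if own c = i then u $ c else x $ c)"

definition nash_equilibrium ::
    "('c \<Rightarrow> 'a) \<Rightarrow> ('a \<Rightarrow> real ^ 'c \<Rightarrow> real) \<Rightarrow> real ^ 'c::finite \<Rightarrow> bool" where
  "nash_equilibrium own J x \<longleftrightarrow> (\<forall>i u. J i x \<le> J i (with_action own i u x))"

definition gradient :: "('v::real_inner \<Rightarrow> real) \<Rightarrow> 'v \<Rightarrow> 'v" where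
  "gradient f x = (THE D. GDERIV f x :> D)"

definition continuously_differentiable :: "('v::real_inner \<Rightarrow> real) \<Rightarrow> bool" where
  "continuously_differentiable f \<longleftrightarrow>
     (\<forall>x. \<exists>D. GDERIV f x :> D) \<and> continuous_on UNIV (gradient f)"

text \<open>
  The function \<open>\<lambda>u. f (with_action own i u x)\<close> does not depend on the coordinates of the agents
  other than \<open>i\<close>, so its gradient vanishes there: \<open>partial_gradient own i f x\<close> is the vector
  \<open>\<partial>f(x)/\<partial>x\<^sub>i\<close> of length \<open>n\<^sub>i\<close>, padded with zeros to length \<open>n\<close>, that is,
  multiplied from the left by the transpose of the selection matrix of agent \<open>i\<close>.
\<close>

definition partial_gradient ::
    "('c \<Rightarrow> 'a) \<Rightarrow> 'a \<Rightarrow> (real ^ 'c \<Rightarrow> real) \<Rightarrow> real ^ 'c \<Rightarrow> real ^ 'c::finite" where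
  "partial_gradient own i f x = gradient (\<lambda>u. f (with_action own i u x)) x"

definition pseudo_gradient ::
    "('c \<Rightarrow> 'a) \<Rightarrow> ('a \<Rightarrow> real ^ 'c \<Rightarrow> real) \<Rightarrow> real ^ 'c \<Rightarrow> real ^ 'c::finite" where
  "pseudo_gradient own J x = (\<chi> c. partial_gradient own (own c) (J (own c)) x $ c)"

definition strongly_monotone :: "real \<Rightarrow> ('v::real_inner \<Rightarrow> 'v) \<Rightarrow> bool" where
  "strongly_monotone \<mu> F \<longleftrightarrow>
     \<mu> > 0 \<and> (\<forall>x y. (F x - F y) \<bullet> (x - y) \<ge> \<mu> * (norm (x - y))\<^sup>2)"

definition radially_unbounded_in ::
    "('c \<Rightarrow> 'a) \<Rightarrow> 'a \<Rightarrow> (real ^ 'c::finite \<Rightarrow> real) \<Rightarrow> bool" where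
  "radially_unbounded_in own i f \<longleftrightarrow>
     (\<forall>B. \<exists>r. \<forall>u. norm (block own i u) \<ge> r \<longrightarrow> f u \<ge> B)"

definition regular_game ::
    "('c \<Rightarrow> 'a) \<Rightarrow> ('a \<Rightarrow> real ^ 'c::finite \<Rightarrow> real) \<Rightarrow> real \<Rightarrow> real \<Rightarrow> bool" where
  "regular_game own J \<mu> L \<longleftrightarrow>
     (\<forall>i x. let f = (\<lambda>u. J i (with_action own i u x)) in
        continuously_differentiable f \<and> convex_on UNIV f \<and> radially_unbounded_in own i f) \<and>
     strongly_monotone \<mu> (pseudo_gradient own J) \<and>
     L-lipschitz_on UNIV (pseudo_gradient own J)"

section \<open>Graphs\<close>

text \<open>The pair \<open>(i, j)\<close> stands for the edge from \<open>j\<close> to \<open>i\<close>.\<close>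

definition in_nbrs :: "('a \<times> 'a) set \<Rightarrow> 'a \<Rightarrow> 'a set" where
  "in_nbrs E i = {j. (i, j) \<in> E}"

definition out_nbrs :: "('a \<times> 'a) set \<Rightarrow> 'a \<Rightarrow> 'a set" where
  "out_nbrs E i = {j. (j, i) \<in> E}"

definition information_robust :: "('a \<times> 'a) set \<Rightarrow> ('a \<times> 'a) set \<Rightarrow> nat \<Rightarrow> 'a \<Rightarrow> bool" where
  "information_robust Ec Eo r m \<longleftrightarrow>
     (\<forall>S. S \<subset> UNIV \<and> out_nbrs Eo m \<subseteq> S \<longrightarrow> (\<exists>j. j \<notin> S \<and> card (in_nbrs Ec j \<inter> S) \<ge> r))"

section \<open>Algorithm\<close>

text \<open>\<open>H\<close> consists of \<open>D\<close> elements of \<open>B\<close> with the highest values \<open>y\<close> (all of \<open>B\<close> if it has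
  fewer than \<open>D\<close> elements); with ties there are several such \<open>H\<close>.\<close>

definition highest :: "nat \<Rightarrow> ('a \<Rightarrow> real) \<Rightarrow> 'a set \<Rightarrow> 'a set \<Rightarrow> bool" where
  "highest D y B H \<longleftrightarrow>
     H \<subseteq> B \<and> card H = min D (card B) \<and> (\<forall>h\<in>H. \<forall>j\<in>B - H. y j \<le> y h)"

text \<open>\<open>Y\<close> is a possible set of retained agents when agent \<open>i\<close> compares the values \<open>y j\<close> received
  from the agents \<open>j \<in> Nin\<close> with its own value \<open>y i\<close>.\<close>

definition retained :: "nat \<Rightarrow> 'a set \<Rightarrow> 'a \<Rightarrow> ('a \<Rightarrow> real) \<Rightarrow> 'a set \<Rightarrow> bool" where
  "retained D Nin i y Y \<longleftrightarrow>
     (\<exists>H H'. highest D y {j \<in> Nin. y j > y i} H \<and>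
             highest D (\<lambda>j. - y j) {j \<in> Nin. y j < y i} H' \<and>
             Y = insert i (Nin - (H \<union> H')))"

definition trimmed_average ::
    "nat \<Rightarrow> real \<Rightarrow> 'a::finite set \<Rightarrow> 'a \<Rightarrow> ('a \<Rightarrow> real) \<Rightarrow> real \<Rightarrow> bool" where
  "trimmed_average D \<eta> Nin i y z \<longleftrightarrow>
     (\<exists>Y w. retained D Nin i y Y \<and>
        (\<Sum>j\<in>UNIV. w j) = 1 \<and> (\<forall>j. j \<notin> Y \<longrightarrow> w j = 0) \<and> (\<forall>j\<in>Y. w j \<ge> \<eta>) \<and>
        z = (\<Sum>j\<in>Y. w j * y j))"

definition supported_average ::
    "real \<Rightarrow> 'a::finite set \<Rightarrow> ('a \<Rightarrow> real) \<Rightarrow> real \<Rightarrow> bool" where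
  "supported_average \<eta> S y z \<longleftrightarrow>
     (\<exists>w. (\<Sum>j\<in>UNIV. w j) = 1 \<and> (\<forall>j. w j \<noteq> 0 \<longrightarrow> j \<in> S \<and> w j \<ge> \<eta>) \<and>
        z = (\<Sum>j\<in>UNIV. w j * y j))"

text \<open>
  \<open>x k $ i\<close> is the estimate vector of agent \<open>i\<close> at iteration \<open>k\<close>, so the true action of
  agent \<open>m\<close> has the components \<open>x k $ m $ c\<close> with \<open>own c = m\<close>; \<open>v k $ i\<close> is the intermediate
  estimate, and \<open>y k i j\<close> is the message from \<open>j\<close> to \<open>i\<close>, relevant only if \<open>j\<close> is an
  in-neighbour of \<open>i\<close> or \<open>j = i\<close>.
\<close>

definition messages ::
    "('a \<times> 'a) set \<Rightarrow> 'a set \<Rightarrow> (nat \<Rightarrow> real ^ 'c ^ 'a::finite) \<Rightarrow>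
     (nat \<Rightarrow> 'a \<Rightarrow> 'a \<Rightarrow> real ^ 'c) \<Rightarrow> bool" where
  "messages Ec T x y \<longleftrightarrow>
     (\<forall>k i. y k i i = x k $ i) \<and>
     (\<forall>k i. \<forall>j \<in> in_nbrs Ec i \<inter> T. y k i j = x k $ j)"

definition action_update ::
    "('c \<Rightarrow> 'a) \<Rightarrow> ('a \<Rightarrow> real ^ 'c \<Rightarrow> real) \<Rightarrow> real \<Rightarrow>
     (nat \<Rightarrow> real ^ 'c ^ 'a) \<Rightarrow> (nat \<Rightarrow> real ^ 'c ^ 'a) \<Rightarrow> 'a::finite \<Rightarrow> nat \<Rightarrow> bool" where
  "action_update own J \<alpha> x v i k \<longleftrightarrow>
     x (Suc k) $ i = v k $ i - \<alpha> *\<^sub>R partial_gradient own i (J i) (v k $ i)"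

definition truthful_dynamics ::
    "('c \<Rightarrow> 'a) \<Rightarrow> ('a \<Rightarrow> real ^ 'c \<Rightarrow> real) \<Rightarrow> ('a \<times> 'a) set \<Rightarrow> ('a \<times> 'a) set \<Rightarrow> 'a set \<Rightarrow>
     nat \<Rightarrow> real \<Rightarrow> real \<Rightarrow> (nat \<Rightarrow> real ^ 'c ^ 'a) \<Rightarrow> (nat \<Rightarrow> real ^ 'c ^ 'a) \<Rightarrow>
     (nat \<Rightarrow> 'a::finite \<Rightarrow> 'a \<Rightarrow> real ^ 'c) \<Rightarrow> bool" where
  "truthful_dynamics own J Ec Eo T D \<eta> \<alpha> x v y \<longleftrightarrow>
     (\<forall>k. \<forall>i\<in>T.
        (\<forall>c. if own c \<in> in_nbrs Eo i
             then v k $ i $ c = x k $ own c $ c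
             else trimmed_average D \<eta> (in_nbrs Ec i) i (\<lambda>j. y k i j $ c) (v k $ i $ c)) \<and>
        action_update own J \<alpha> x v i k)"

definition adversarial_dynamics ::
    "('c \<Rightarrow> 'a) \<Rightarrow> ('a \<Rightarrow> real ^ 'c \<Rightarrow> real) \<Rightarrow> ('a \<times> 'a) set \<Rightarrow> ('a \<times> 'a) set \<Rightarrow> 'a set \<Rightarrow>
     'a set \<Rightarrow> real \<Rightarrow> real \<Rightarrow> (nat \<Rightarrow> real ^ 'c ^ 'a) \<Rightarrow> (nat \<Rightarrow> real ^ 'c ^ 'a::finite) \<Rightarrow> bool" where
  "adversarial_dynamics own J Ec Eo T A \<eta> \<alpha> x v \<longleftrightarrow>
     (\<forall>k. \<forall>i\<in>A.
        (\<forall>c. if own c \<in> in_nbrs Eo i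
             then v k $ i $ c = x k $ own c $ c
             else supported_average \<eta> (in_nbrs Ec i \<inter> T) (\<lambda>j. x k $ j $ c) (v k $ i $ c)) \<and>
        action_update own J \<alpha> x v i k)"

section \<open>Step size\<close>

definition contraction_const :: "nat \<Rightarrow> real \<Rightarrow> real" where
  "contraction_const N \<eta> = 1 - (\<eta> / 2) ^ (N - 1)"

text \<open>If \<open>N = 1\<close>, the exponent \<open>2 / (N - 1)\<close> is \<open>0\<close> and \<open>0 powr 0 = 0\<close>, so the value is \<open>4\<close>.\<close>

definition p_bar :: "nat \<Rightarrow> real \<Rightarrow> real" where
  "p_bar N \<eta> = 4 * real N / (1 - contraction_const N \<eta> powr (2 / (real N - 1)))"

definition step_matrix :: "real \<Rightarrow> real \<Rightarrow> real \<Rightarrow> real \<Rightarrow> real ^ 2 ^ 2" where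
  "step_matrix p \<mu> L \<alpha> = vector [
     vector [2 * \<alpha> * \<mu> - p * \<alpha>\<^sup>2 * L\<^sup>2, - \<alpha> * p * L * (1 + \<alpha> * L)],
     vector [- \<alpha> * p * L * (1 + \<alpha> * L), 1 - 2 * \<alpha> * (p - 1) * L - p * \<alpha>\<^sup>2 * L\<^sup>2]]"

definition positive_definite :: "real ^ 'n ^ 'n \<Rightarrow> bool" where
  "positive_definite M \<longleftrightarrow> transpose M = M \<and> (\<forall>z. z \<noteq> 0 \<longrightarrow> z \<bullet> (M *v z) > 0)"

end

theory Submission
  imports Defs
begin

text \<open>
  Fix a coordinate of agent \<open>m\<close>. By information robustness the agents can be arranged in levels: the
  observers of \<open>m\<close> form level 0, and a truthful agent of positive level has more than \<open>D\<close> truthful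
  in-neighbours of smaller level. Removing the \<open>D\<close> extreme values on either side keeps the average
  within the range of the truthful values and leaves weight at least \<open>\<eta>\<close> on a value no further from
  the true action than the estimates of smaller level. Hence the estimation errors contract in one
  step, up to the displacement of the true action, in a maximum norm whose weights increase with the
  level.

  If \<open>n\<close> is the vector of the resulting error bounds (one per coordinate), the function
  \<open>\<parallel>X - x\<^sup>*\<parallel>\<^sup>2 + \<kappa> \<parallel>n\<parallel>\<^sup>2\<close> of the true profile \<open>X\<close> and of \<open>n\<close> decreases in each iteration by at least the
  quadratic form of the step-size matrix at \<open>(\<parallel>X - x\<^sup>*\<parallel>, sqrt (N - 1) \<parallel>n\<parallel>)\<close>, since the
  constants of the weighted norm stay below those expressed by \<open>p_bar\<close>.
\<close>

section \<open>Trimmed averages and robust graphs\<close>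

text \<open>If a value above \<open>y i\<close> survives, then \<open>D\<close> values at least as
  large have been removed; together with \<open>j\<close> these are \<open>D + 1\<close>
  in-neighbours, which cannot all lie in \<open>A\<close>. Applied to \<open>- y\<close>, the same
  argument covers the low side.\<close>

lemma retained_value_le:
  fixes y :: "'a::finite \<Rightarrow> real"
  assumes "highest D y {j \<in> I. y i < y j} H" and "card (I \<inter> A) \<le> D"
    and "j \<in> I - H" and "y i < y j"
  shows "\<exists>t\<in>I - A. y j \<le> y t"
proof -
  let ?B = "{j \<in> I. y i < y j}"
  have H: "H \<subseteq> ?B" "card H = min D (card ?B)" "\<forall>h\<in>H. \<forall>j\<in>?B - H. y j \<le> y h"
    using assms(1) unfolding highest_def by auto
  have "card H < card ?B"
    using H(1) assms(3,4) by (intro psubset_card_mono) auto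
  with H(2) have "card H = D" by simp
  with assms(3) have "card (insert j H) = Suc D" by simp
  then have "\<not> insert j H \<subseteq> I \<inter> A"
    using card_mono[of "I \<inter> A" "insert j H"] assms(2) by auto
  moreover have "insert j H \<subseteq> I" using H(1) assms(3) by auto
  ultimately obtain t where "t \<in> insert j H" "t \<in> I - A" by blast
  then show ?thesis using H(3) assms(3,4) by (intro bexI[of _ t]) auto
qed

text \<open>
  Either some truthful value close to \<open>a\<close> is retained, or all of them are removed; being more than
  \<open>D\<close>, they then lie on both sides of \<open>y i\<close>, so that \<open>y i\<close> itself is close to \<open>a\<close>.
\<close>

lemma trimmed_average_dist:
  fixes y :: "'a::finite \<Rightarrow> real"
  assumes avg: "trimmed_average D \<eta> I i y z" and "0 < \<eta>"
    and few: "card (I \<inter> A) \<le> D" and many: "D < card (I \<inter> R)"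
    and M: "\<And>j. j \<in> insert i (I - A) \<Longrightarrow> \<bar>y j - a\<bar> \<le> M"
    and s: "\<And>j. j \<in> I \<inter> R \<Longrightarrow> \<bar>y j - a\<bar> \<le> s" and "s \<le> M"
  shows "\<bar>z - a\<bar> \<le> \<eta> * s + (1 - \<eta>) * M"
proof -
  obtain Y w where Y: "retained D I i y Y" and w1: "(\<Sum>j\<in>UNIV. w j) = 1"
    and w0: "\<forall>j. j \<notin> Y \<longrightarrow> w j = 0" and w\<eta>: "\<forall>j\<in>Y. w j \<ge> \<eta>" and z: "z = (\<Sum>j\<in>Y. w j * y j)"
    using avg unfolding trimmed_average_def by blast
  obtain H H' where H: "highest D y {j \<in> I. y i < y j} H"
    and H': "highest D (\<lambda>j. - y j) {j \<in> I. - y i < - y j} H'"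
    and Yeq: "Y = insert i (I - (H \<union> H'))"
    using Y unfolding retained_def by auto
  have "i \<in> Y" using Yeq by simp
  have bound: "\<bar>y j - a\<bar> \<le> M" if Y: "j \<in> Y" for j
  proof -
    consider "y j = y i" | "j \<in> I - H" "y i < y j" | "j \<in> I - H'" "- y i < - y j"
      using Y Yeq by (cases "j = i"; cases "y j < y i"; cases "y i < y j"; auto)
    then show ?thesis
    proof cases
      case 1
      then show ?thesis using M[of i] by simp
    next
      case 2
      from retained_value_le[OF H few 2] obtain t where "t \<in> I - A" "y j \<le> y t" by blast
      then show ?thesis using 2 M[of i] M[of t] by auto
    next
      case 3
      from retained_value_le[OF H' few 3] obtain t where "t \<in> I - A" "y t \<le> y j" by auto
      then show ?thesis using 3 M[of i] M[of t] by auto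
    qed
  qed
  have "\<exists>j\<in>Y. \<bar>y j - a\<bar> \<le> s"
  proof (cases "I \<inter> R \<inter> Y = {}")
    case False
    then show ?thesis using s by blast
  next
    case True
    then have sub: "I \<inter> R \<subseteq> H \<union> H'" using Yeq by auto
    have "card H \<le> D" "card H' \<le> D" using H H' unfolding highest_def by auto
    then have "\<not> I \<inter> R \<subseteq> H" "\<not> I \<inter> R \<subseteq> H'"
      using many card_mono[of H "I \<inter> R"] card_mono[of H' "I \<inter> R"] by auto
    with sub obtain r r' where "r \<in> I \<inter> R" "r \<in> H" "r' \<in> I \<inter> R" "r' \<in> H'" by blast
    moreover from this have "y i < y r" "y r' < y i"
      using H H' unfolding highest_def by auto
    ultimately have "\<bar>y i - a\<bar> \<le> s" using s[of r] s[of r'] by auto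
    then show ?thesis using \<open>i \<in> Y\<close> by blast
  qed
  then obtain j where j: "j \<in> Y" "\<bar>y j - a\<bar> \<le> s" by blast
  have sumY: "(\<Sum>j\<in>Y. w j) = 1"
    using w1 w0 by (subst sum.mono_neutral_left[of UNIV Y w]) auto
  have "z - a = (\<Sum>j\<in>Y. w j * (y j - a))"
    using sumY by (simp add: z right_diff_distrib sum_subtractf flip: sum_distrib_right)
  also have "\<bar>\<dots>\<bar> \<le> (\<Sum>j\<in>Y. w j * \<bar>y j - a\<bar>)"
    using w\<eta> \<open>0 < \<eta>\<close> by (intro order_trans[OF sum_abs] sum_mono) (auto simp: abs_mult)
  also have "\<dots> = w j * \<bar>y j - a\<bar> + (\<Sum>k\<in>Y - {j}. w k * \<bar>y k - a\<bar>)"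
    using j by (simp add: sum.remove)
  also have "\<dots> \<le> w j * s + (\<Sum>k\<in>Y - {j}. w k * M)"
    using w\<eta> \<open>0 < \<eta>\<close> j bound by (intro add_mono sum_mono mult_left_mono) force+
  also have "\<dots> = w j * s + (1 - w j) * M"
    using j sumY by (simp add: sum.remove flip: sum_distrib_right)
  also have "\<dots> = M - w j * (M - s)" by (simp add: algebra_simps)
  \<comment> \<open>Since \<open>s \<le> M\<close>, the bound decreases in the weight
    \<open>w j\<close>, which is at least \<open>\<eta>\<close>.\<close>
  also have "\<dots> \<le> M - \<eta> * (M - s)"
    using w\<eta> j \<open>s \<le> M\<close> by (simp add: mult_right_mono)
  finally show ?thesis by (simp add: algebra_simps)
qed

lemma supported_average_dist:
  fixes y :: "'a::finite \<Rightarrow> real"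
  assumes avg: "supported_average \<eta> S y z" and "0 < \<eta>"
    and M: "\<And>j. j \<in> S \<Longrightarrow> \<bar>y j - a\<bar> \<le> M"
  shows "\<bar>z - a\<bar> \<le> M"
proof -
  obtain w where w1: "(\<Sum>j\<in>UNIV. w j) = 1" and w: "\<forall>j. w j \<noteq> 0 \<longrightarrow> j \<in> S \<and> w j \<ge> \<eta>"
    and z: "z = (\<Sum>j\<in>UNIV. w j * y j)"
    using avg unfolding supported_average_def by blast
  have w0: "w j \<ge> 0" for j using w \<open>0 < \<eta>\<close> by (cases "w j = 0") force+
  have "z - a = (\<Sum>j\<in>UNIV. w j * (y j - a))"
    using w1 by (simp add: z right_diff_distrib sum_subtractf flip: sum_distrib_right)
  also have "\<bar>\<dots>\<bar> \<le> (\<Sum>j\<in>UNIV. w j * \<bar>y j - a\<bar>)"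
    using w0 by (intro order_trans[OF sum_abs] sum_mono) (auto simp: abs_mult)
  also have "\<dots> \<le> (\<Sum>j\<in>UNIV. w j * M)"
  proof (rule sum_mono)
    fix j
    show "w j * \<bar>y j - a\<bar> \<le> w j * M"
      using w0[of j] w M[of j] by (cases "w j = 0") (auto intro: mult_left_mono)
  qed
  also have "\<dots> = M" using w1 by (simp flip: sum_distrib_right)
  finally show ?thesis .
qed

text \<open>The set of observers can be enlarged one agent at a time. A largest set carrying a
  suitable ranking contains all agents: otherwise robustness supplies an outside agent with
  \<open>r\<close> in-neighbours in the set, and this agent can be ranked above all members.\<close>

lemma information_robust_ranking:
  fixes Ec :: "('a::finite \<times> 'a) set"
  assumes "information_robust Ec Eo r m"
  obtains f :: "'a \<Rightarrow> nat" where
    "\<And>i. i \<notin> out_nbrs Eo m \<Longrightarrow> r \<le> card (in_nbrs Ec i \<inter> {j. f j < f i})"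
proof -
  let ?O = "out_nbrs Eo m"
  define good where "good S f \<longleftrightarrow> ?O \<subseteq> S \<and>
    (\<forall>i\<in>S - ?O. r \<le> card (in_nbrs Ec i \<inter> {j \<in> S. f j < f i}))" for S and f :: "'a \<Rightarrow> nat"
  have "\<exists>f. good ?O f" by (simp add: good_def)
  then obtain S where S: "\<exists>f. good S f" and max: "\<And>S'. \<exists>f. good S' f \<Longrightarrow> card S' \<le> card S"
    using ex_has_greatest_nat[of "\<lambda>S. \<exists>f. good S f" ?O card "Suc (card (UNIV :: 'a set))"]
    by (force simp: less_Suc_eq_le intro: card_mono)
  from S obtain f where f: "good S f" by blast
  have "S = UNIV"
  proof (rule ccontr)
    assume "S \<noteq> UNIV"
    with assms f obtain j where j: "j \<notin> S" "r \<le> card (in_nbrs Ec j \<inter> S)"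
      unfolding information_robust_def good_def by blast
    define f' where "f' = f(j := Suc (Max (f ` S)))"
    have lt: "f' k < f' j" if "k \<in> S" for k
      using that j(1) by (auto simp: f'_def less_Suc_eq_le)
    have "r \<le> card (in_nbrs Ec i \<inter> {k \<in> insert j S. f' k < f' i})" if "i \<in> insert j S - ?O" for i
    proof (cases "i = j")
      case True
      then show ?thesis using j(2) lt
        by (intro order_trans[OF j(2)] card_mono) auto
    next
      case False
      then have "r \<le> card (in_nbrs Ec i \<inter> {k \<in> S. f k < f i})"
        using that f unfolding good_def by auto
      also have "\<dots> \<le> card (in_nbrs Ec i \<inter> {k \<in> insert j S. f' k < f' i})"
        using False j(1) by (intro card_mono) (auto simp: f'_def)
      finally show ?thesis .
    qed
    then have "good (insert j S) f'" using f unfolding good_def by blast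
    then show False using max[of "insert j S"] j(1) by auto
  qed
  then show thesis using f that[of f] by (simp add: good_def)
qed

text \<open>
  Adversaries are put above all truthful agents. This costs no extra level: if an adversary does not
  observe \<open>m\<close>, then there are at most \<open>CARD('a) - 2\<close> truthful agents that do not.
\<close>

lemma truthful_levels:
  fixes Ec :: "('a::finite \<times> 'a) set"
  assumes TA: "T \<union> A = UNIV" "T \<inter> A = {}"
    and few: "\<forall>i\<in>T. card (in_nbrs Ec i \<inter> A) \<le> D"
    and robust: "information_robust Ec Eo (2 * D + 1) m"
    and m: "m \<in> out_nbrs Eo m"
  obtains l :: "'a \<Rightarrow> nat" where
    "\<And>i. l i = 0 \<longleftrightarrow> i \<in> out_nbrs Eo m" and "\<And>i. l i \<le> CARD('a) - 1"
    and "\<And>i. i \<in> T \<Longrightarrow> i \<notin> out_nbrs Eo m \<Longrightarrow> D < card (in_nbrs Ec i \<inter> {j \<in> T. l j < l i})"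
    and "\<And>i j. i \<in> A \<Longrightarrow> i \<notin> out_nbrs Eo m \<Longrightarrow> j \<in> T \<Longrightarrow> l j < l i"
proof -
  let ?O = "out_nbrs Eo m"
  obtain f :: "'a \<Rightarrow> nat" where
    f: "\<And>i. i \<notin> ?O \<Longrightarrow> 2 * D + 1 \<le> card (in_nbrs Ec i \<inter> {j. f j < f i})"
    using information_robust_ranking[OF robust] by blast
  \<comment> \<open>Ranks may be arbitrarily large; counting the truthful non-observers of rank at
    most \<open>f i\<close> keeps their order and compresses them to levels of size at most
    \<open>CARD('a) - 1\<close>.\<close>
  define l where "l i = (if i \<in> ?O then 0
    else if i \<in> T then card {j \<in> T - ?O. f j \<le> f i} else Suc (card (T - ?O)))" for i
  have pos: "0 < card {j \<in> T - ?O. f j \<le> f i}" if "i \<in> T - ?O" for i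
    using that by (auto simp: card_gt_0_iff)
  have le: "l i \<le> card (T - ?O)" if "i \<in> T" for i
    using that by (auto simp: l_def intro: card_mono)
  show thesis
  proof (rule that)
    show "l i = 0 \<longleftrightarrow> i \<in> ?O" for i using pos[of i] by (auto simp: l_def)
    show "l j < l i" if "i \<in> A" "i \<notin> ?O" "j \<in> T" for i j
    proof -
      have "i \<notin> T" using that TA by auto
      then show ?thesis using that le[of j] by (simp add: l_def)
    qed
    show "l i \<le> CARD('a) - 1" for i
    proof -
      have "card (T - ?O) \<le> card (UNIV - {m})" using m by (intro card_mono) auto
      moreover have "card (insert i (T - ?O)) \<le> card (UNIV - {m})" if "i \<notin> ?O"
        using m that by (intro card_mono) auto
      ultimately show ?thesis
        using le[of i] by (cases "i \<in> T") (auto simp: l_def)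
    qed
    show "D < card (in_nbrs Ec i \<inter> {j \<in> T. l j < l i})" if "i \<in> T" "i \<notin> ?O" for i
    proof -
      have "l j < l i" if "j \<in> T" "f j < f i" for j
      proof (cases "j \<in> ?O")
        case True
        then show ?thesis using pos[of i] \<open>i \<in> T\<close> \<open>i \<notin> ?O\<close> by (simp add: l_def)
      next
        case False
        have "{k \<in> T - ?O. f k \<le> f j} \<subset> {k \<in> T - ?O. f k \<le> f i}"
        proof (rule psubsetI)
          have "i \<in> {k \<in> T - ?O. f k \<le> f i} - {k \<in> T - ?O. f k \<le> f j}"
            using that \<open>i \<in> T\<close> \<open>i \<notin> ?O\<close> by auto
          then show "{k \<in> T - ?O. f k \<le> f j} \<noteq> {k \<in> T - ?O. f k \<le> f i}" by blast
        qed (use that in auto)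
        then show ?thesis using that False \<open>i \<in> T\<close> \<open>i \<notin> ?O\<close>
          by (simp add: l_def psubset_card_mono)
      qed
      \<comment> \<open>Of at least \<open>2 * D + 1\<close> in-neighbours of smaller rank, at most
        \<open>D\<close> are adversaries, so more than \<open>D\<close> truthful ones
        remain.\<close>
      then have "in_nbrs Ec i \<inter> {j. f j < f i} \<subseteq>
          (in_nbrs Ec i \<inter> A) \<union> (in_nbrs Ec i \<inter> {j \<in> T. l j < l i})"
        using TA by auto
      then have "2 * D + 1 \<le> card ((in_nbrs Ec i \<inter> A) \<union> (in_nbrs Ec i \<inter> {j \<in> T. l j < l i}))"
        using f[OF that(2)] by (meson card_mono finite order_trans)
      then show ?thesis
        using few that(1) card_Un_le[of "in_nbrs Ec i \<inter> A" "in_nbrs Ec i \<inter> {j \<in> T. l j < l i}"]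
        by fastforce
    qed
  qed
qed

section \<open>Weights of the levels\<close>

text \<open>Here \<open>\<omega>\<close> and \<open>1 - u * \<omega>\<close> are the weight of the
  lowest positive level and the contraction rate in \<open>level_weights\<close>. As
  \<open>\<omega> \<le> 1\<close>, the factor \<open>1 - (1 - u * \<omega>)\<^sup>2\<close> is at
  least \<open>u * (2 - u) * \<omega>\<close>, and \<open>u * (2 - u)\<close> cancels the
  denominator of \<open>p_bar\<close> up to a geometric sum.\<close>

lemma p_bar_bound:
  fixes K :: nat and \<eta> :: real
  assumes "0 < \<eta>" "\<eta> \<le> 1" "1 \<le> K"
  defines "u \<equiv> (\<eta> / 2) ^ K"
  defines "\<omega> \<equiv> (1 - \<eta> / 2) / (1 - u)"
  shows "K \<le> (p_bar (Suc K) \<eta> - 1) * (1 - (1 - u * \<omega>)\<^sup>2) * \<omega>\<^sup>2"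
proof -
  define C where "C = 1 - u"
  \<comment> \<open>\<open>1 / (1 - r)\<close> becomes comparable with \<open>K / u\<close> through the geometric sum \<open>\<sigma>\<close>.\<close>
  define r where "r = C powr (2 / K)"
  define \<sigma> where "\<sigma> = (\<Sum>i<K. r ^ i)"
  have u: "0 < u" "u \<le> 1 / 2" "u \<le> \<eta> / 2"
    using assms(1-3) power_decreasing[of 1 K "\<eta> / 2"] by (auto simp: u_def)
  have \<omega>: "1 / 2 \<le> \<omega>" "\<omega> \<le> 1"
    using u assms(1-3) unfolding \<omega>_def by (simp_all add: divide_le_eq le_divide_eq)
  have C: "0 < C" "C < 1" using u by (auto simp: C_def)
  have rK: "r ^ K = C\<^sup>2"
    using C assms(3) by (simp add: r_def powr_power)
  have r: "0 < r" "r < 1"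
    using C assms(3) powr_less_mono2[of "2 / K" C 1] by (auto simp: r_def)
  have \<sigma>: "(1 - r) * \<sigma> = u * (2 - u)"
    unfolding \<sigma>_def one_diff_power_eq[symmetric] rK by (simp add: C_def power2_eq_square algebra_simps)
  have u1: "u * (2 - u) \<le> 1"
    using zero_le_power2[of "1 - u"] by (simp add: power2_eq_square algebra_simps)
  have p: "p_bar (Suc K) \<eta> = 4 * (real K + 1) / (1 - r)"
    by (simp add: p_bar_def contraction_const_def r_def C_def u_def add.commute)
  have p\<sigma>: "(p_bar (Suc K) \<eta> - 1) * (u * (2 - u)) \<ge> 4 * (real K + 1) * \<sigma> - 1"
  proof -
    have "p_bar (Suc K) \<eta> * (u * (2 - u)) = 4 * (real K + 1) * \<sigma>"
      unfolding p \<sigma>[symmetric] using r by simp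
    then show ?thesis using u1 by (simp add: left_diff_distrib)
  qed
  \<comment> \<open>For \<open>K = 1\<close> the crude bound \<open>\<omega> \<ge> 1 / 2\<close>
    would give only 7/8, but there \<open>\<omega>\<close> is exactly 1. For
    \<open>K \<ge> 2\<close> each summand of \<open>\<sigma>\<close> is at least
    \<open>r ^ K\<close>, hence at least 9/16; so the first factor grows quadratically in
    \<open>K\<close> and outweighs the loss 1/8 from \<open>\<omega> ^ 3\<close>.\<close>
  have main: "K \<le> (4 * (real K + 1) * \<sigma> - 1) * \<omega> ^ 3"
  proof (cases "K = 1")
    case True
    then have "\<omega> = 1" "\<sigma> = 1" using u by (auto simp: \<omega>_def \<sigma>_def u_def)
    then show ?thesis using True by simp
  next
    case False
    with assms(3) have K: "2 \<le> K" by simp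
    have "u \<le> 1 / 4"
      using power_decreasing[of 2 K "\<eta> / 2"] assms(1,2) K power_mono[of "\<eta> / 2" "1 / 2" 2]
      by (simp add: u_def power2_eq_square)
    then have C2: "9 / 16 \<le> C\<^sup>2"
      using power_mono[of "3 / 4" C 2] by (simp add: C_def power2_eq_square)
    have "(\<Sum>i\<in>{1..<K}. 9 / 16) \<le> (\<Sum>i\<in>{1..<K}. r ^ i)"
      using r by (intro sum_mono order_trans[OF C2]) (auto simp flip: rK intro: power_decreasing)
    moreover have "\<sigma> = 1 + (\<Sum>i\<in>{1..<K}. r ^ i)"
      using K by (simp add: \<sigma>_def lessThan_atLeast0 sum.atLeast_Suc_lessThan)
    ultimately have \<sigma>': "\<sigma> \<ge> (9 * real K + 7) / 16" using K by (simp add: of_nat_diff field_simps)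
    have "8 * real K \<le> 4 * (real K + 1) * ((9 * real K + 7) / 16) - 1"
    proof -
      have "0 \<le> (real K - 2) * (9 * real K + 2) + 7" using K by simp
      then show ?thesis by (simp add: field_simps)
    qed
    also have "\<dots> \<le> 4 * (real K + 1) * \<sigma> - 1"
      using \<sigma>' by (intro diff_mono mult_left_mono) auto
    finally have "8 * real K \<le> 4 * (real K + 1) * \<sigma> - 1" .
    moreover have "1 / 8 \<le> \<omega> ^ 3" using power_mono[OF \<omega>(1), of 3] by (simp add: power3_eq_cube)
    ultimately have "(8 * real K) * (1 / 8) \<le> (4 * (real K + 1) * \<sigma> - 1) * \<omega> ^ 3"
      by (intro mult_mono) auto
    then show ?thesis by simp
  qed
  have p1: "0 \<le> p_bar (Suc K) \<eta> - 1" using r by (simp add: p field_simps)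
  have "u * (2 - u) * \<omega> \<le> 1 - (1 - u * \<omega>)\<^sup>2"
  proof -
    have "1 - (1 - u * \<omega>)\<^sup>2 - u * (2 - u) * \<omega> = u\<^sup>2 * \<omega> * (1 - \<omega>)"
      by (simp add: power2_eq_square algebra_simps)
    moreover have "\<dots> \<ge> 0" using \<omega> by simp
    ultimately show ?thesis by linarith
  qed
  then have "(p_bar (Suc K) \<eta> - 1) * (u * (2 - u) * \<omega>) * \<omega>\<^sup>2 \<le>
      (p_bar (Suc K) \<eta> - 1) * (1 - (1 - u * \<omega>)\<^sup>2) * \<omega>\<^sup>2"
    using p1 by (intro mult_right_mono mult_left_mono) auto
  moreover have "(4 * (real K + 1) * \<sigma> - 1) * \<omega> ^ 3 \<le>
      (p_bar (Suc K) \<eta> - 1) * (u * (2 - u)) * \<omega> ^ 3"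
    using p\<sigma> \<omega> by (intro mult_right_mono) auto
  ultimately show ?thesis using main by (simp add: power2_eq_square power3_eq_cube mult.assoc)
qed

text \<open>
  With \<open>\<epsilon> = \<eta> / 2\<close> and \<open>K = N - 1\<close> the weights are \<open>\<omega> t = (1 - \<epsilon> ^ t) / (1 - \<epsilon> ^ K)\<close>, the lower bound is
  \<open>\<theta> = \<omega> 1\<close>, and the rate \<open>\<rho> = 1 - \<epsilon> ^ K * \<omega> 1\<close> is dictated by the top level.
\<close>

lemma level_weights:
  fixes N :: nat and \<eta> :: real
  assumes "0 < \<eta>" "\<eta> \<le> 1" "1 \<le> N"
  obtains \<omega> :: "nat \<Rightarrow> real" and \<rho> \<theta> :: real where
    "\<omega> 0 = 0" and "mono_on {..N - 1} \<omega>" and "\<And>t. t \<le> N - 1 \<Longrightarrow> \<omega> t \<le> 1"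
    and "\<And>t. Suc t \<le> N - 1 \<Longrightarrow> \<theta> \<le> \<omega> (Suc t)"
    and "\<And>t. Suc t \<le> N - 1 \<Longrightarrow> \<eta> / 2 * \<omega> t + (1 - \<eta> / 2) \<le> \<rho> * \<omega> (Suc t)"
    and "0 \<le> \<rho>" "\<rho> < 1" "0 < \<theta>" "\<theta> \<le> 1" "real (N - 1) \<le> (p_bar N \<eta> - 1) * (1 - \<rho>\<^sup>2) * \<theta>\<^sup>2"
proof (cases "N = 1")
  case True
  \<comment> \<open>A single agent has level 0 only, so the conditions on positive levels are void.
    The last inequality reads \<open>0 \<le> 3\<close>, as \<open>p_bar\<close> is 4 by the
    convention \<open>0 powr 0 = 0\<close>.\<close>
  show thesis
    by (rule that[of "\<lambda>_. 0" 1 0]) (auto simp: True p_bar_def contraction_const_def mono_on_def)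
next
  case False
  define K where "K = N - 1"
  have K: "1 \<le> K" "N = Suc K" using False assms(3) by (auto simp: K_def)
  define \<epsilon> where "\<epsilon> = \<eta> / 2"
  define u where "u = \<epsilon> ^ K"
  define \<omega> where "\<omega> t = (1 - \<epsilon> ^ t) / (1 - u)" for t :: nat
  have \<epsilon>: "0 < \<epsilon>" "\<epsilon> \<le> 1 / 2" using assms by (auto simp: \<epsilon>_def)
  have u: "0 < u" "u \<le> 1 / 2" "u \<le> \<epsilon>"
    using \<epsilon> K(1) power_decreasing[of 1 K \<epsilon>] by (auto simp: u_def)
  have mono: "\<omega> s \<le> \<omega> t" if "s \<le> t" for s t
    using that \<epsilon> u by (auto simp: \<omega>_def intro!: divide_right_mono power_decreasing)
  have \<omega>K: "\<omega> K = 1" using u by (simp add: \<omega>_def u_def)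
  have \<omega>1: "0 < \<omega> 1" "\<omega> 1 \<le> 1" using \<epsilon> u by (auto simp: \<omega>_def)
  have u\<omega>: "u * \<omega> 1 \<le> 1" using u \<omega>1 mult_mono[of u 1 "\<omega> 1" 1] by simp
  have step: "\<epsilon> * \<omega> t + (1 - \<epsilon>) \<le> (1 - u * \<omega> 1) * \<omega> (Suc t)" if "Suc t \<le> K" for t
  proof -
    have le: "\<omega> (Suc t) \<le> 1" using mono[OF that] \<omega>K by simp
    \<comment> \<open>The weights are built so that the gain \<open>u * \<omega> 1\<close> is the
      same at every level; relative to \<open>\<omega> (Suc t) \<le> 1\<close> it is smallest at the
      top.\<close>
    have "\<epsilon> * \<omega> t + (1 - \<epsilon>) = \<omega> (Suc t) - u * \<omega> 1"
    proof -
      have "\<omega> (Suc t) - u * \<omega> 1 = (1 - \<epsilon> ^ Suc t - u * (1 - \<epsilon>)) / (1 - u)"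
        by (simp add: \<omega>_def flip: diff_divide_distrib)
      moreover have "\<epsilon> * \<omega> t + (1 - \<epsilon>) = (\<epsilon> * (1 - \<epsilon> ^ t) + (1 - \<epsilon>) * (1 - u)) / (1 - u)"
        using u by (simp add: \<omega>_def add_divide_distrib)
      ultimately show ?thesis by (simp add: algebra_simps)
    qed
    also have "\<dots> \<le> \<omega> (Suc t) - u * \<omega> 1 * \<omega> (Suc t)"
      using le u \<omega>1 mult_left_mono[of "\<omega> (Suc t)" 1 "u * \<omega> 1"] by simp
    finally show ?thesis by (simp add: algebra_simps)
  qed
  show thesis
  proof (rule that[of \<omega> "\<omega> 1" "1 - u * \<omega> 1"])
    show "real (N - 1) \<le> (p_bar N \<eta> - 1) * (1 - (1 - u * \<omega> 1)\<^sup>2) * (\<omega> 1)\<^sup>2"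
      using p_bar_bound[OF assms(1,2) K(1)] by (simp add: K \<omega>_def u_def \<epsilon>_def)
    show "\<eta> / 2 * \<omega> t + (1 - \<eta> / 2) \<le> (1 - u * \<omega> 1) * \<omega> (Suc t)" if "Suc t \<le> N - 1" for t
      using step[of t] that by (simp add: K_def \<epsilon>_def)
    show "\<omega> t \<le> 1" if "t \<le> N - 1" for t
      using mono[of t K] that \<omega>K by (simp add: K_def)
  qed (use \<omega>1 u\<omega> u mono in \<open>auto simp: mono_on_def \<omega>_def[of 0]\<close>)
qed

section \<open>Equilibria and strongly monotone maps\<close>

lemma gradient_eqI:
  assumes "GDERIV f x :> D"
  shows "gradient f x = D"
  unfolding gradient_def
proof (rule the_equality)
  fix D' assume "GDERIV f x :> D'"
  then have "(\<lambda>h. h \<bullet> D') = (\<lambda>h. h \<bullet> D)"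
    using assms unfolding gderiv_def by (rule has_derivative_unique)
  then show "D' = D"
    by (intro vector_eq_ldot[THEN iffD1]) meson
qed (rule assms)

lemma with_action_self [simp]: "with_action own i x x = x"
  by (simp add: with_action_def vec_eq_iff)

lemma regular_game_GDERIV:
  assumes "regular_game own J \<mu> L"
  shows "GDERIV (\<lambda>u. J i (with_action own i u x)) x :> partial_gradient own i (J i) x"
  using assms gradient_eqI
  unfolding regular_game_def continuously_differentiable_def partial_gradient_def Let_def
  by metis

text \<open>The function is constant along the axis \<open>c\<close>. For the iteration this means
  that Step 3 moves only an agent's own action and leaves its estimates of the others at their
  intermediate values.\<close>

lemma partial_gradient_other:
  assumes "regular_game own J \<mu> L" and "own c \<noteq> i"
  shows "partial_gradient own i (J i) x $ c = 0"
proof -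
  let ?f = "\<lambda>u. J i (with_action own i u x)" and ?D = "partial_gradient own i (J i) x"
  have "(?f has_derivative (\<lambda>h. h \<bullet> ?D)) (at (x + 0 *\<^sub>R axis c 1))"
    using regular_game_GDERIV[OF assms(1)] by (simp add: gderiv_def)
  then have "((\<lambda>t. ?f (x + t *\<^sub>R axis c 1)) has_derivative (\<lambda>t. (t *\<^sub>R axis c 1) \<bullet> ?D)) (at (0 :: real))"
    by (rule has_derivative_compose[rotated]) (auto intro!: derivative_eq_intros)
  moreover have "with_action own i (x + t *\<^sub>R axis c 1) x = x" for t :: real
    using assms(2) by (auto simp: with_action_def vec_eq_iff axis_def)
  ultimately have "((\<lambda>t::real. J i x) has_derivative (\<lambda>t. (t *\<^sub>R axis c 1) \<bullet> ?D)) (at 0)"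
    by simp
  then have "(\<lambda>t::real. (t *\<^sub>R axis c 1) \<bullet> ?D) = (\<lambda>t. 0)"
    by (rule has_derivative_unique) simp
  from fun_cong[OF this, of 1] show ?thesis by (simp add: inner_axis')
qed

lemma partial_gradient_own:
  "own c = i \<Longrightarrow> partial_gradient own i (J i) x $ c = pseudo_gradient own J x $ c"
  by (simp add: pseudo_gradient_def)

text \<open>On the line through \<open>x\<close> and \<open>u\<close> this is the tangent inequality
  in one variable, with slope 0.\<close>

lemma convex_on_min_at_zero_gradient:
  fixes f :: "'v::real_inner \<Rightarrow> real"
  assumes "convex_on UNIV f" and "GDERIV f x :> 0"
  shows "f x \<le> f u"
proof -
  define g where "g t = f (x + t *\<^sub>R (u - x))" for t :: real
  have "convex_on UNIV g"
  proof (rule convex_onI)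
    fix t a b :: real assume t: "0 < t" "t < 1"
    have "g ((1 - t) *\<^sub>R a + t *\<^sub>R b) = f ((1 - t) *\<^sub>R (x + a *\<^sub>R (u - x)) + t *\<^sub>R (x + b *\<^sub>R (u - x)))"
      by (simp add: g_def algebra_simps)
    also have "\<dots> \<le> (1 - t) * g a + t * g b"
      unfolding g_def using t by (intro convex_onD[OF assms(1)]) auto
    finally show "g ((1 - t) *\<^sub>R a + t *\<^sub>R b) \<le> (1 - t) * g a + t * g b" .
  qed simp
  moreover have "(g has_derivative (\<lambda>t. 0)) (at 0)"
  proof -
    have "(f has_derivative (\<lambda>h. 0)) (at (x + 0 *\<^sub>R (u - x)))"
      using assms(2) by (simp add: gderiv_def)
    then have "((\<lambda>t. f (x + t *\<^sub>R (u - x))) has_derivative (\<lambda>t. 0)) (at (0 :: real))"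
      by (rule has_derivative_compose[rotated]) (auto intro!: derivative_eq_intros)
    then show ?thesis by (simp add: g_def[abs_def])
  qed
  then have "(g has_real_derivative 0) (at 0)"
    by (simp add: has_field_derivative_def lambda_zero)
  ultimately have "g 1 - g 0 \<ge> 0 * (1 - 0)"
    by (intro convex_on_imp_above_tangent[where A = UNIV]) auto
  then show ?thesis by (simp add: g_def)
qed

text \<open>Convexity in the own action makes the first-order condition sufficient. The
  pseudo-gradient sees only own coordinates, but the remaining ones of each partial gradient vanish
  anyway.\<close>

lemma nash_equilibrium_iff_pseudo_gradient:
  assumes "regular_game own J \<mu> L"
  shows "nash_equilibrium own J z \<longleftrightarrow> pseudo_gradient own J z = 0"
proof
  assume nash: "nash_equilibrium own J z"
  have "partial_gradient own i (J i) z = 0" for i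
  proof -
    have "((\<lambda>u. J i (with_action own i u z)) has_derivative
        (\<lambda>h. h \<bullet> partial_gradient own i (J i) z)) (at z)"
      using regular_game_GDERIV[OF assms] by (simp add: gderiv_def)
    then have "(\<lambda>h. h \<bullet> partial_gradient own i (J i) z) = (\<lambda>h. 0)"
      by (rule has_derivative_local_min) (use nash in \<open>simp add: nash_equilibrium_def\<close>)
    then show ?thesis by (metis inner_eq_zero_iff)
  qed
  then show "pseudo_gradient own J z = 0" by (simp add: pseudo_gradient_def vec_eq_iff)
next
  assume zero: "pseudo_gradient own J z = 0"
  show "nash_equilibrium own J z"
    unfolding nash_equilibrium_def
  proof (intro allI)
    fix i u
    have "partial_gradient own i (J i) z = 0"
      using partial_gradient_other[OF assms] partial_gradient_own[of own] zero
      by (metis vec_eq_iff zero_index)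
    then have "GDERIV (\<lambda>u. J i (with_action own i u z)) z :> 0"
      using regular_game_GDERIV[OF assms, of i z] by simp
    moreover have "convex_on UNIV (\<lambda>u. J i (with_action own i u z))"
      using assms by (simp add: regular_game_def Let_def)
    ultimately have "J i (with_action own i z z) \<le> J i (with_action own i u z)"
      by (rule convex_on_min_at_zero_gradient[rotated])
    then show "J i z \<le> J i (with_action own i u z)" by simp
  qed
qed

lemma norm_diff_scaleR_squared:
  fixes d e :: "'v::real_inner"
  shows "(norm (d - s *\<^sub>R e))\<^sup>2 = (norm d)\<^sup>2 - 2 * s * (e \<bullet> d) + s\<^sup>2 * (norm e)\<^sup>2"
  unfolding power2_norm_eq_inner
  by (simp add: inner_diff inner_commute power2_eq_square algebra_simps)

lemma strongly_monotone_zero_unique: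
  assumes "strongly_monotone \<mu> F" "F x = 0" "F z = 0"
  shows "z = x"
proof -
  have "\<mu> > 0" "\<mu> * (norm (z - x))\<^sup>2 \<le> (F z - F x) \<bullet> (z - x)"
    using assms(1) unfolding strongly_monotone_def by auto
  then show ?thesis using assms(2,3) by (simp add: mult_le_0_iff)
qed

text \<open>Zeros of \<open>F\<close> are the fixed points of the map sending \<open>x\<close> to
  \<open>x - s *\<^sub>R F x\<close>, which is a contraction for suitable \<open>s\<close>, so that
  Banach's theorem applies.\<close>

lemma strongly_monotone_lipschitz_zero_exists:
  fixes F :: "'v::{real_inner,complete_space} \<Rightarrow> 'v"
  assumes mono: "strongly_monotone \<mu> F" and lip: "L-lipschitz_on UNIV F"
  shows "\<exists>x. F x = 0"
proof -
  have \<mu>: "\<mu> > 0" using mono by (simp add: strongly_monotone_def)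
  \<comment> \<open>Enlarging the Lipschitz constant makes it positive and at least
    \<open>\<mu>\<close>, so that \<open>q\<close> below is nonnegative.\<close>
  define l where "l = L + \<mu>"
  have L: "0 \<le> L" using lip by (rule lipschitz_on_nonneg)
  then have l: "l > 0" "\<mu> \<le> l" using \<mu> by (auto simp: l_def)
  \<comment> \<open>This \<open>s\<close> minimizes
    \<open>1 - 2 * s * \<mu> + s\<^sup>2 * l\<^sup>2\<close>; the minimum is
    \<open>q\<close>.\<close>
  define s where "s = \<mu> / l\<^sup>2"
  define q where "q = 1 - \<mu>\<^sup>2 / l\<^sup>2"
  have s: "s > 0" using \<mu> l by (simp add: s_def)
  have q: "0 \<le> q" "q < 1"
    using \<mu> l power_mono[of \<mu> l 2] by (auto simp: q_def)
  have "dist (x - s *\<^sub>R F x) (z - s *\<^sub>R F z) \<le> sqrt q * dist x z" for x z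
  proof (rule power2_le_imp_le)
    let ?d = "x - z" and ?e = "F x - F z"
    have e: "norm ?e \<le> l * norm ?d"
      using lipschitz_onD[OF lip, of x z] \<mu>
      by (simp add: dist_norm l_def distrib_right add_increasing2)
    have "(dist (x - s *\<^sub>R F x) (z - s *\<^sub>R F z))\<^sup>2 = (norm (?d - s *\<^sub>R ?e))\<^sup>2"
      by (simp add: dist_norm algebra_simps)
    also have "\<dots> = (norm ?d)\<^sup>2 - 2 * s * (?e \<bullet> ?d) + s\<^sup>2 * (norm ?e)\<^sup>2"
      by (simp add: norm_diff_scaleR_squared)
    also have "\<dots> \<le> (norm ?d)\<^sup>2 - 2 * s * (\<mu> * (norm ?d)\<^sup>2) + s\<^sup>2 * (l * norm ?d)\<^sup>2"
      using mono s e unfolding strongly_monotone_def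
      by (intro add_mono diff_mono mult_left_mono power_mono) auto
    also have "\<dots> = (1 - 2 * s * \<mu> + s\<^sup>2 * l\<^sup>2) * (norm ?d)\<^sup>2"
      by (simp add: algebra_simps power_mult_distrib)
    also have "1 - 2 * s * \<mu> + s\<^sup>2 * l\<^sup>2 = q"
      using l by (simp add: s_def q_def field_simps power2_eq_square)
    finally show "(dist (x - s *\<^sub>R F x) (z - s *\<^sub>R F z))\<^sup>2 \<le> (sqrt q * dist x z)\<^sup>2"
      using q by (simp add: power_mult_distrib dist_norm)
  qed (use q in simp)
  moreover have "sqrt q < 1" "0 \<le> sqrt q" using q by auto
  ultimately have "\<exists>!x. x - s *\<^sub>R F x = x"
    by (intro banach_fix_type[of "sqrt q"]) auto
  then show ?thesis using s by auto
qed

lemma positive_definite_step_matrix_form: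
  fixes a b :: real
  assumes "positive_definite (step_matrix p \<mu> L \<alpha>)" and "a \<noteq> 0 \<or> b \<noteq> 0"
  shows "0 < (2 * \<alpha> * \<mu> - p * \<alpha>\<^sup>2 * L\<^sup>2) * a\<^sup>2 - 2 * (\<alpha> * p * L * (1 + \<alpha> * L)) * (a * b)
    + (1 - 2 * \<alpha> * (p - 1) * L - p * \<alpha>\<^sup>2 * L\<^sup>2) * b\<^sup>2"
proof -
  let ?z = "vector [a, b] :: real ^ 2"
  have "?z \<noteq> 0"
    using assms(2) by (auto simp: vec_eq_iff forall_2)
  then have "0 < ?z \<bullet> (step_matrix p \<mu> L \<alpha> *v ?z)"
    using assms(1) unfolding positive_definite_def by blast
  then show ?thesis
    by (simp add: step_matrix_def inner_vec_def matrix_vector_mult_def sum_2 power2_eq_square algebra_simps)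
qed

lemma positive_quadratic_form_coercive:
  fixes A B C :: real
  assumes "\<And>a b. a \<noteq> 0 \<or> b \<noteq> 0 \<Longrightarrow> 0 < A * a\<^sup>2 - 2 * B * (a * b) + C * b\<^sup>2"
  obtains m where "0 < m" "\<And>a b. m * (a\<^sup>2 + b\<^sup>2) \<le> A * a\<^sup>2 - 2 * B * (a * b) + C * b\<^sup>2"
proof -
  have A: "0 < A" using assms[of 1 0] by simp
  have C: "0 < C" using assms[of 0 1] by simp
  \<comment> \<open>For second argument \<open>A\<close>, the form is smallest at first argument
    \<open>B\<close>; its value there is \<open>A\<close> times the determinant.\<close>
  have "0 < A * (A * C - B\<^sup>2)"
    using assms[of B A] A by (simp add: power2_eq_square algebra_simps)
  then have det: "0 < A * C - B\<^sup>2" using A by (simp add: zero_less_mult_iff)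
  \<comment> \<open>Determinant over trace is the product of the two eigenvalues over their sum,
    hence below the smaller one.\<close>
  define m where "m = (A * C - B\<^sup>2) / (A + C)"
  have m: "0 < m" using A C det by (simp add: m_def)
  have Am: "(A - m) * (A + C) = A\<^sup>2 + B\<^sup>2"
    using A C by (simp add: m_def field_simps power2_eq_square)
  have pos: "0 < A - m"
    using Am A C by (metis add_pos_nonneg add_pos_pos zero_le_power2 zero_less_mult_pos2 zero_less_power)
  have mm: "(A - m) * (C - m) - B\<^sup>2 = m\<^sup>2"
  proof -
    have "m * (A + C) = A * C - B\<^sup>2" using A C by (simp add: m_def)
    then show ?thesis by (simp add: power2_eq_square algebra_simps)
  qed
  show thesis
  proof (rule that[OF m])
    fix a b
    have "(A - m) * ((A - m) * a\<^sup>2 - 2 * B * (a * b) + (C - m) * b\<^sup>2) =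
        ((A - m) * a - B * b)\<^sup>2 + ((A - m) * (C - m) - B\<^sup>2) * b\<^sup>2"
      by (simp add: power2_eq_square algebra_simps)
    also have "\<dots> \<ge> 0" unfolding mm by simp
    finally have "0 \<le> (A - m) * a\<^sup>2 - 2 * B * (a * b) + (C - m) * b\<^sup>2"
      using pos by (simp add: zero_le_mult_iff)
    then show "m * (a\<^sup>2 + b\<^sup>2) \<le> A * a\<^sup>2 - 2 * B * (a * b) + C * b\<^sup>2"
      by (simp add: algebra_simps)
  qed
qed

section \<open>Convergence\<close>

text \<open>
  The previous gradient step moved the true action by \<open>\<beta>\<close> in absolute value, hence the term \<open>\<beta>\<close> in
  the error of every estimate. It does not depend on the level, so dividing by the smallest positive
  weight \<open>\<theta>\<close> turns it into a multiple of \<open>\<omega> (l i)\<close>.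
\<close>

lemma intermediate_estimate_error:
  fixes xs vs :: "'a::finite \<Rightarrow> real" and ys :: "'a \<Rightarrow> 'a \<Rightarrow> real" and l :: "'a \<Rightarrow> nat"
  assumes TA: "T \<union> A = UNIV" "T \<inter> A = {}" and "0 < \<eta>" "\<eta> \<le> 1"
    and few: "\<forall>i\<in>T. card (in_nbrs Ec i \<inter> A) \<le> D"
    and l0: "\<And>i. l i = 0 \<longleftrightarrow> i \<in> B" and lN: "\<And>i. l i \<le> K"
    and lT: "\<And>i. i \<in> T \<Longrightarrow> i \<notin> B \<Longrightarrow> D < card (in_nbrs Ec i \<inter> {j \<in> T. l j < l i})"
    and lA: "\<And>i j. i \<in> A \<Longrightarrow> i \<notin> B \<Longrightarrow> j \<in> T \<Longrightarrow> l j < l i"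
    and \<omega>0: "\<omega> 0 = 0" and \<omega>mono: "mono_on {..K} \<omega>" and \<omega>1: "\<And>t. t \<le> K \<Longrightarrow> \<omega> t \<le> 1"
    and \<theta>: "\<And>t. Suc t \<le> K \<Longrightarrow> \<theta> \<le> \<omega> (Suc t)" "0 < \<theta>"
    and \<rho>: "\<And>t. Suc t \<le> K \<Longrightarrow> \<eta> / 2 * \<omega> t + (1 - \<eta> / 2) \<le> \<rho> * \<omega> (Suc t)"
    and observed: "\<And>i. i \<in> B \<Longrightarrow> vs i = a"
    and truthful: "\<And>i. i \<in> T \<Longrightarrow> i \<notin> B \<Longrightarrow> trimmed_average D \<eta> (in_nbrs Ec i) i (ys i) (vs i)"
    and adversarial: "\<And>i. i \<in> A \<Longrightarrow> i \<notin> B \<Longrightarrow> supported_average \<eta> (in_nbrs Ec i \<inter> T) xs (vs i)"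
    and ys: "\<And>i j. j \<in> insert i (in_nbrs Ec i \<inter> T) \<Longrightarrow> ys i j = xs j"
    and err: "\<And>j. \<bar>xs j - a\<bar> \<le> \<omega> (l j) * n + \<beta>" and "0 \<le> n" "0 \<le> \<beta>"
  shows "\<bar>vs i - a\<bar> \<le> \<omega> (l i) * (\<rho> * n + \<beta> / \<theta>)"
proof (cases "l i")
  case 0
  then show ?thesis using l0[of i] observed[of i] by (simp add: \<omega>0)
next
  case (Suc t)
  then have i: "i \<notin> B" using l0[of i] by simp
  have t: "Suc t \<le> K" using lN[of i] Suc by simp
  have t1: "\<omega> t \<le> 1" using \<omega>1 t by simp
  have below: "\<bar>xs j - a\<bar> \<le> \<omega> t * n + \<beta>" if "l j < l i" for j
  proof -
    have "\<omega> (l j) \<le> \<omega> t" using that Suc t by (intro mono_onD[OF \<omega>mono]) auto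
    then show ?thesis using err[of j] mult_right_mono[of "\<omega> (l j)" "\<omega> t" n] \<open>0 \<le> n\<close> by simp
  qed
  have all: "\<bar>xs j - a\<bar> \<le> n + \<beta>" for j
    using err[of j] mult_right_mono[OF \<omega>1[OF lN[of j]], of n] \<open>0 \<le> n\<close> by simp
  have "\<bar>vs i - a\<bar> \<le> (\<eta> / 2 * \<omega> t + (1 - \<eta> / 2)) * n + \<beta>"
  proof (cases "i \<in> T")
    case True
    have "\<bar>vs i - a\<bar> \<le> \<eta> * (\<omega> t * n + \<beta>) + (1 - \<eta>) * (n + \<beta>)"
    proof (rule trimmed_average_dist[OF truthful[OF True i] \<open>0 < \<eta>\<close> _ lT[OF True i]])
      show "card (in_nbrs Ec i \<inter> A) \<le> D" using few True by blast
      show "\<bar>ys i j - a\<bar> \<le> n + \<beta>" if "j \<in> insert i (in_nbrs Ec i - A)" for j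
      proof -
        have "j \<in> insert i (in_nbrs Ec i \<inter> T)" using that TA by auto
        then show ?thesis using ys all by simp
      qed
      show "\<bar>ys i j - a\<bar> \<le> \<omega> t * n + \<beta>" if "j \<in> in_nbrs Ec i \<inter> {j \<in> T. l j < l i}" for j
        using that ys[of j i] below[of j] by auto
      show "\<omega> t * n + \<beta> \<le> n + \<beta>" using mult_right_mono[OF t1 \<open>0 \<le> n\<close>] by simp
    qed
    also have "\<dots> = (1 - \<eta> * (1 - \<omega> t)) * n + \<beta>" by (simp add: algebra_simps)
    \<comment> \<open>Passing to \<open>\<eta> / 2\<close> matches the constant in
      \<open>contraction_const\<close> and keeps the lowest positive weight at least 1/2.\<close>
    also have "\<dots> \<le> (1 - \<eta> / 2 * (1 - \<omega> t)) * n + \<beta>"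
      using t1 \<open>0 < \<eta>\<close> \<open>0 \<le> n\<close> by (intro add_right_mono mult_right_mono diff_left_mono) auto
    finally show ?thesis by (simp add: algebra_simps diff_divide_distrib)
  next
    case False
    then have "i \<in> A" using TA by auto
    \<comment> \<open>An adversary averages truthful values only, and all of these come from smaller
      levels, so the better bound applies to its whole average.\<close>
    have "\<bar>vs i - a\<bar> \<le> \<omega> t * n + \<beta>"
      using below lA[OF \<open>i \<in> A\<close> i]
      by (intro supported_average_dist[OF adversarial[OF \<open>i \<in> A\<close> i] \<open>0 < \<eta>\<close>]) auto
    also have "\<omega> t * n \<le> (\<eta> / 2 * \<omega> t + (1 - \<eta> / 2)) * n"
    proof (rule mult_right_mono[OF _ \<open>0 \<le> n\<close>])
      have "0 \<le> (1 - \<eta> / 2) * (1 - \<omega> t)" using t1 \<open>\<eta> \<le> 1\<close> by simp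
      then show "\<omega> t \<le> \<eta> / 2 * \<omega> t + (1 - \<eta> / 2)"
        by (simp add: algebra_simps diff_divide_distrib)
    qed
    finally show ?thesis by simp
  qed
  also have "\<dots> \<le> \<rho> * \<omega> (Suc t) * n + \<omega> (Suc t) * (\<beta> / \<theta>)"
  proof (rule add_mono)
    show "(\<eta> / 2 * \<omega> t + (1 - \<eta> / 2)) * n \<le> \<rho> * \<omega> (Suc t) * n"
      using \<rho>[OF t] \<open>0 \<le> n\<close> by (rule mult_right_mono)
    show "\<beta> \<le> \<omega> (Suc t) * (\<beta> / \<theta>)"
      using mult_right_mono[OF \<theta>(1)[OF t] \<open>0 \<le> \<beta>\<close>] \<theta>(2) by (simp add: field_simps)
  qed
  finally show ?thesis by (simp add: Suc algebra_simps)
qed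

lemma norm_vec_squared: "(norm u)\<^sup>2 = (\<Sum>c\<in>UNIV. (u $ c)\<^sup>2)" for u :: "real ^ 'c"
  unfolding power2_norm_eq_inner by (simp add: inner_vec_def power2_eq_square)

text \<open>The action part is a gradient step with a gradient wrong by at most
  \<open>L * b\<close>. The weight \<open>\<kappa>\<close> makes the factor \<open>\<rho>\<close> in
  \<open>n'\<close> gain exactly \<open>b\<^sup>2\<close>, while
  \<open>\<kappa> / \<theta>\<^sup>2 \<le> p - 1\<close> controls what the displacement adds to
  \<open>n'\<close>. The coefficient 1 of the action part and \<open>p - 1\<close> of the error part
  sum to the \<open>p\<close> of the step-size matrix.\<close>

lemma lyapunov_decrease:
  fixes X g xs n n' :: "real ^ 'c::finite" and K :: nat and p \<alpha> \<mu> L \<rho> \<theta> :: real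
  assumes mono: "strongly_monotone \<mu> F" and lip: "L-lipschitz_on UNIV F" and zero: "F xs = 0"
    and \<alpha>: "0 < \<alpha>" and err: "(norm (g - F X))\<^sup>2 \<le> L\<^sup>2 * (K * (norm n)\<^sup>2)"
    and n': "\<And>c. n' $ c = \<rho> * n $ c + \<alpha> / \<theta> * \<bar>g $ c\<bar>"
    and \<rho>: "0 \<le> \<rho>" "\<rho> < 1" and \<theta>: "0 < \<theta>" "\<theta> \<le> 1" and K: "K \<le> (p - 1) * (1 - \<rho>\<^sup>2) * \<theta>\<^sup>2"
  defines "a \<equiv> norm (X - xs)" and "b \<equiv> sqrt K * norm n" and "\<kappa> \<equiv> K / (1 - \<rho>\<^sup>2)"
  shows "(norm (X - \<alpha> *\<^sub>R g - xs))\<^sup>2 + \<kappa> * (norm n')\<^sup>2 \<le> a\<^sup>2 + \<kappa> * (norm n)\<^sup>2 -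
    ((2 * \<alpha> * \<mu> - p * \<alpha>\<^sup>2 * L\<^sup>2) * a\<^sup>2 - 2 * (\<alpha> * p * L * (1 + \<alpha> * L)) * (a * b)
      + (1 - 2 * \<alpha> * (p - 1) * L - p * \<alpha>\<^sup>2 * L\<^sup>2) * b\<^sup>2)"
proof -
  have L: "0 \<le> L" using lip by (rule lipschitz_on_nonneg)
  have \<rho>2: "0 < 1 - \<rho>\<^sup>2" using \<rho> by (simp add: power_less_one_iff abs_square_less_1)
  have ab: "0 \<le> a" "0 \<le> b" by (auto simp: a_def b_def)
  have \<kappa>: "0 \<le> \<kappa>" using \<rho>2 by (simp add: \<kappa>_def)
  have b2: "b\<^sup>2 = K * (norm n)\<^sup>2" by (simp add: b_def power_mult_distrib)
  have \<kappa>p: "\<kappa> / \<theta>\<^sup>2 \<le> p - 1"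
    using K \<rho>2 \<theta> by (simp add: \<kappa>_def pos_divide_le_eq mult_ac)
  have "0 \<le> \<kappa> / \<theta>\<^sup>2" using \<kappa> by simp
  with \<kappa>p have p1: "0 \<le> p - 1" by linarith
  have gF: "norm (g - F X) \<le> L * b"
  proof (rule power2_le_imp_le)
    show "(norm (g - F X))\<^sup>2 \<le> (L * b)\<^sup>2" using err by (simp only: b2 power_mult_distrib)
  qed (use L ab in simp)
  have FX: "norm (F X) \<le> L * a"
    using lipschitz_onD[OF lip, of X xs] zero by (simp add: dist_norm a_def)
  have G: "norm g \<le> L * a + L * b"
    using norm_triangle_ineq[of "g - F X" "F X"] gF FX by simp
  have G2: "(norm g)\<^sup>2 \<le> (L * a + L * b)\<^sup>2" using G by (rule power_mono) simp
  have cross: "g \<bullet> (X - xs) \<ge> \<mu> * a\<^sup>2 - L * b * a"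
  proof -
    have "g \<bullet> (X - xs) = (F X - F xs) \<bullet> (X - xs) + (g - F X) \<bullet> (X - xs)"
      by (simp add: zero inner_diff_left)
    moreover have "(F X - F xs) \<bullet> (X - xs) \<ge> \<mu> * a\<^sup>2"
      using mono by (simp add: strongly_monotone_def a_def)
    moreover have "\<bar>(g - F X) \<bullet> (X - xs)\<bar> \<le> L * b * a"
      using Cauchy_Schwarz_ineq2[of "g - F X" "X - xs"] mult_right_mono[OF gF ab(1)] by (simp add: a_def)
    ultimately show ?thesis by linarith
  qed
  have action: "(norm (X - \<alpha> *\<^sub>R g - xs))\<^sup>2 \<le>
      a\<^sup>2 - 2 * \<alpha> * (\<mu> * a\<^sup>2 - L * b * a) + \<alpha>\<^sup>2 * (L * a + L * b)\<^sup>2"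
  proof -
    have "(norm (X - \<alpha> *\<^sub>R g - xs))\<^sup>2 = (norm (X - xs - \<alpha> *\<^sub>R g))\<^sup>2" by (simp add: algebra_simps)
    also have "\<dots> = a\<^sup>2 - 2 * \<alpha> * (g \<bullet> (X - xs)) + \<alpha>\<^sup>2 * (norm g)\<^sup>2"
      by (simp add: norm_diff_scaleR_squared a_def)
    also have "\<dots> \<le> a\<^sup>2 - 2 * \<alpha> * (\<mu> * a\<^sup>2 - L * b * a) + \<alpha>\<^sup>2 * (L * a + L * b)\<^sup>2"
      using cross G2 \<alpha> by (intro add_mono diff_mono mult_left_mono) auto
    finally show ?thesis .
  qed
  have norm_n': "norm n' \<le> \<rho> * norm n + \<alpha> / \<theta> * norm g"
  proof -
    define h where "h = (\<chi> c. \<bar>g $ c\<bar>)"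
    have "n' = \<rho> *\<^sub>R n + (\<alpha> / \<theta>) *\<^sub>R h" by (simp add: vec_eq_iff n' h_def)
    moreover have "norm h = norm g" by (simp add: h_def norm_vec_def)
    ultimately show ?thesis
      using norm_triangle_ineq[of "\<rho> *\<^sub>R n" "(\<alpha> / \<theta>) *\<^sub>R h"] \<rho> \<alpha> \<theta> by simp
  qed
  \<comment> \<open>As \<open>\<rho> * \<theta> \<le> 1\<close>, one factor
    \<open>1 / \<theta>\<close> may be worsened to \<open>1 / \<theta>\<^sup>2\<close>, so that the
    bound on \<open>\<kappa> / \<theta>\<^sup>2\<close> applies. The comparison of
    \<open>norm n\<close> with \<open>b\<close> needs \<open>K \<ge> 1\<close>; for
    \<open>K = 0\<close> both sides vanish.\<close>
  have \<kappa>n: "\<kappa> * \<rho> / \<theta> * norm n \<le> (p - 1) * b"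
  proof (cases "K = 0")
    case False
    have "\<kappa> * \<rho> / \<theta> \<le> \<kappa> / \<theta>\<^sup>2"
    proof -
      have "\<rho> * \<theta> \<le> 1" using \<rho> \<theta> mult_le_one[of \<rho> \<theta>] by simp
      then have "\<kappa> * (\<rho> * \<theta>) / \<theta>\<^sup>2 \<le> \<kappa> * 1 / \<theta>\<^sup>2"
        using \<kappa> by (intro divide_right_mono mult_left_mono) auto
      then show ?thesis using \<theta> by (simp add: power2_eq_square)
    qed
    also note \<kappa>p
    finally have "\<kappa> * \<rho> / \<theta> * norm n \<le> (p - 1) * norm n" by (rule mult_right_mono) simp
    also have "norm n \<le> b"
      using False mult_right_mono[of 1 "sqrt K" "norm n"] by (simp add: b_def)
    finally show ?thesis using p1 by (simp add: mult_left_mono)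
  qed (simp add: \<kappa>_def b_def)
  have "\<kappa> * (norm n')\<^sup>2 \<le> \<kappa> * (\<rho> * norm n + \<alpha> / \<theta> * norm g)\<^sup>2"
    using norm_n' \<kappa> by (intro mult_left_mono power_mono) auto
  also have "\<dots> = \<kappa> * \<rho>\<^sup>2 * (norm n)\<^sup>2 + 2 * \<alpha> * (\<kappa> * \<rho> / \<theta> * norm n) * norm g
      + \<kappa> / \<theta>\<^sup>2 * \<alpha>\<^sup>2 * (norm g)\<^sup>2"
    by (simp add: power2_eq_square algebra_simps)
  also have "\<kappa> * \<rho>\<^sup>2 * (norm n)\<^sup>2 = \<kappa> * (norm n)\<^sup>2 - b\<^sup>2"
    using \<rho>2 by (simp add: b2 \<kappa>_def field_simps)
  also have "2 * \<alpha> * (\<kappa> * \<rho> / \<theta> * norm n) * norm g \<le> 2 * \<alpha> * ((p - 1) * b) * (L * a + L * b)"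
    using \<alpha> p1 ab by (intro mult_mono[OF mult_left_mono[OF \<kappa>n] G]) auto
  also have "\<kappa> / \<theta>\<^sup>2 * \<alpha>\<^sup>2 * (norm g)\<^sup>2 \<le> (p - 1) * \<alpha>\<^sup>2 * (L * a + L * b)\<^sup>2"
    using \<kappa>p G2 p1 by (intro mult_mono) auto
  finally have "\<kappa> * (norm n')\<^sup>2 \<le> \<kappa> * (norm n)\<^sup>2 - b\<^sup>2
      + 2 * \<alpha> * ((p - 1) * b) * (L * a + L * b) + (p - 1) * \<alpha>\<^sup>2 * (L * a + L * b)\<^sup>2" by simp
  with action show ?thesis by (simp add: power2_eq_square algebra_simps)
qed

lemma nonneg_decrease_tendsto_zero:
  fixes V f :: "nat \<Rightarrow> real"
  assumes "0 < m" "\<And>k. 0 \<le> V k" "\<And>k. 0 \<le> f k" "\<And>k. V (Suc k) \<le> V k - m * f k"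
  shows "f \<longlonglongrightarrow> 0"
proof (rule summable_LIMSEQ_zero, rule bounded_imp_summable)
  fix k
  have "m * (\<Sum>i\<le>k. f i) \<le> V 0 - V (Suc k)"
  proof (induction k)
    case (Suc k)
    then show ?case using assms(4)[of "Suc k"] by (simp add: distrib_left)
  qed (use assms(4)[of 0] in simp)
  then have "m * (\<Sum>i\<le>k. f i) \<le> V 0" using assms(2)[of "Suc k"] by linarith
  then show "(\<Sum>i\<le>k. f i) \<le> V 0 / m" using assms(1) by (simp add: field_simps)
qed (use assms(3) in auto)

theorem theorem1:
  fixes own :: "'c::finite \<Rightarrow> 'a::finite"
    and J :: "'a \<Rightarrow> real ^ 'c \<Rightarrow> real"
    and Ec Eo :: "('a \<times> 'a) set"
    and T A :: "'a set"
    and D :: nat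
    and \<mu> L \<eta> \<alpha> :: real
    and x v :: "nat \<Rightarrow> real ^ 'c ^ 'a"
    and y :: "nat \<Rightarrow> 'a \<Rightarrow> 'a \<Rightarrow> real ^ 'c"
  assumes "T \<union> A = UNIV" and "T \<inter> A = {}"
    and "\<forall>i. (i, i) \<in> Eo"
    and "0 < \<eta>" and "\<eta> \<le> 1"
    and A1: "regular_game own J \<mu> L"
    and A2: "\<forall>i\<in>T. card (in_nbrs Ec i \<inter> A) \<le> D \<and> card (in_nbrs Ec i) \<ge> 2 * D + 1"
    and A3: "adversarial_dynamics own J Ec Eo T A \<eta> \<alpha> x v"
    and A4: "\<forall>m. information_robust Ec Eo (2 * D + 1) m"
    and "positive_definite (step_matrix (p_bar CARD('a) \<eta>) \<mu> L \<alpha>)"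
    and "messages Ec T x y"
    and "truthful_dynamics own J Ec Eo T D \<eta> \<alpha> x v y"
  shows "\<exists>xstar. nash_equilibrium own J xstar \<and>
           (\<forall>z. nash_equilibrium own J z \<longrightarrow> z = xstar) \<and>
           x \<longlonglongrightarrow> (\<chi> i. xstar)"
proof -

  \<comment> \<open>Equilibrium, level weights and sign of the step size\<close>
  let ?K = "CARD('a) - 1" and ?F = "pseudo_gradient own J"
  let ?p = "p_bar CARD('a) \<eta>"
  have game: "strongly_monotone \<mu> ?F" "L-lipschitz_on UNIV ?F"
    using A1 by (auto simp: regular_game_def)
  obtain xstar where xstar: "?F xstar = 0"
    using strongly_monotone_lipschitz_zero_exists[OF game] by blast
  have nash: "nash_equilibrium own J z \<longleftrightarrow> ?F z = 0" for z
    using A1 by (rule nash_equilibrium_iff_pseudo_gradient)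
  obtain \<omega> :: "nat \<Rightarrow> real" and \<rho> \<theta> :: real where \<omega>:
    "\<omega> 0 = 0" "mono_on {..?K} \<omega>" "\<And>t. t \<le> ?K \<Longrightarrow> \<omega> t \<le> 1" "\<And>t. Suc t \<le> ?K \<Longrightarrow> \<theta> \<le> \<omega> (Suc t)"
    "\<And>t. Suc t \<le> ?K \<Longrightarrow> \<eta> / 2 * \<omega> t + (1 - \<eta> / 2) \<le> \<rho> * \<omega> (Suc t)"
    and \<rho>\<theta>: "0 \<le> \<rho>" "\<rho> < 1" "0 < \<theta>" "\<theta> \<le> 1"
    and K: "real ?K \<le> (?p - 1) * (1 - \<rho>\<^sup>2) * \<theta>\<^sup>2"
    using level_weights[OF assms(4,5), of "CARD('a)"] by (metis One_nat_def Suc_leI zero_less_card_finite)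
  obtain m where m: "0 < m" and form: "\<And>a b. m * (a\<^sup>2 + b\<^sup>2) \<le>
      (2 * \<alpha> * \<mu> - ?p * \<alpha>\<^sup>2 * L\<^sup>2) * a\<^sup>2 - 2 * (\<alpha> * ?p * L * (1 + \<alpha> * L)) * (a * b)
      + (1 - 2 * \<alpha> * (?p - 1) * L - ?p * \<alpha>\<^sup>2 * L\<^sup>2) * b\<^sup>2"
    using positive_quadratic_form_coercive[OF positive_definite_step_matrix_form[OF assms(10)]] by blast
  \<comment> \<open>The first diagonal entry of the matrix is at least \<open>m\<close>, and since
    \<open>?p \<ge> 1\<close> it is at most \<open>2 * \<alpha> * \<mu>\<close>.\<close>
  have \<alpha>: "0 < \<alpha>"
  proof -
    have "0 \<le> (?p - 1) * ((1 - \<rho>\<^sup>2) * \<theta>\<^sup>2)" 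
      using order_trans[OF of_nat_0_le_iff K] by (simp only: mult.assoc)
    moreover have "0 < (1 - \<rho>\<^sup>2) * \<theta>\<^sup>2" using \<rho>\<theta> by (simp add: power_less_one_iff abs_square_less_1)
    ultimately have "1 \<le> ?p" by (simp add: zero_le_mult_iff)
    then have "0 \<le> ?p * \<alpha>\<^sup>2 * L\<^sup>2" by simp
    moreover have "m \<le> 2 * \<alpha> * \<mu> - ?p * \<alpha>\<^sup>2 * L\<^sup>2" using form[of 1 0] by simp
    ultimately have "0 < \<alpha> * \<mu>" using m by linarith
    then show ?thesis using game(1) by (simp add: strongly_monotone_def zero_less_mult_iff)
  qed
  have update: "x (Suc k) $ i = v k $ i - \<alpha> *\<^sub>R partial_gradient own i (J i) (v k $ i)" for k i
    using assms(1,8,12) unfolding adversarial_dynamics_def truthful_dynamics_def action_update_def by blast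
  have observed: "v k $ i $ c = x k $ own c $ c" if "own c \<in> in_nbrs Eo i" for k i c
    using assms(1,8,12) that unfolding adversarial_dynamics_def truthful_dynamics_def
    by (metis UNIV_I UnE)

  \<comment> \<open>The true profile and its perturbed gradient step\<close>
  define X where "X k = (\<chi> c. x k $ own c $ c)" for k
  \<comment> \<open>Every agent evaluates its gradient at its own intermediate estimate, so
    \<open>g k\<close> combines pseudo-gradients at different points; with exact estimates it would
    be \<open>?F (X k)\<close>.\<close>
  define g where "g k = (\<chi> c. ?F (v k $ own c) $ c)" for k
  have vX: "v k $ own c $ c = X k $ c" for k c
    using observed[of c "own c" k] assms(3) by (simp add: X_def in_nbrs_def)
  have X_Suc: "X (Suc k) = X k - \<alpha> *\<^sub>R g k" for k
    by (simp add: vec_eq_iff X_def[of "Suc k"] update partial_gradient_own g_def vX)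
  have x_Suc: "x (Suc k) $ i $ c = (if i = own c then X (Suc k) $ c else v k $ i $ c)" for k i c
    using partial_gradient_other[OF A1, of c i] by (auto simp: update X_def)

  \<comment> \<open>Bounds on the estimation errors\<close>
  define b0 where "b0 = (\<Sum>c\<in>UNIV. \<Sum>i\<in>UNIV. \<bar>x 0 $ i $ c - X 0 $ c\<bar>)"
  \<comment> \<open>The recursion is the bound of \<open>intermediate_estimate_error\<close> with
    \<open>\<beta> = \<alpha> * \<bar>g k $ c\<bar>\<close>; the initial value is the same bound
    with \<open>n = 0\<close> and \<open>\<beta> = b0\<close>.\<close>
  define n where "n = rec_nat (\<chi> c. b0 / \<theta>) (\<lambda>k u. \<chi> c. \<rho> * u $ c + \<alpha> / \<theta> * \<bar>g k $ c\<bar>)"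
  have n_0: "n 0 $ c = b0 / \<theta>" and n_Suc: "n (Suc k) $ c = \<rho> * n k $ c + \<alpha> / \<theta> * \<bar>g k $ c\<bar>" for k c
    by (simp_all add: n_def)
  have b0: "0 \<le> b0" by (simp add: b0_def sum_nonneg)
  have n_nonneg: "0 \<le> n k $ c" for k c
    by (induction k) (use \<rho>\<theta> \<alpha> b0 in \<open>auto simp: n_0 n_Suc\<close>)
  have x0: "\<bar>x 0 $ i $ c - X 0 $ c\<bar> \<le> b0" for i c
  proof -
    have "\<bar>x 0 $ i $ c - X 0 $ c\<bar> \<le> (\<Sum>i\<in>UNIV. \<bar>x 0 $ i $ c - X 0 $ c\<bar>)"
      by (rule member_le_sum) auto
    also have "\<dots> \<le> b0" unfolding b0_def
      by (rule member_le_sum[of c UNIV "\<lambda>c. \<Sum>i\<in>UNIV. \<bar>x 0 $ i $ c - X 0 $ c\<bar>"]) (auto simp: sum_nonneg)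
    finally show ?thesis .
  qed
  have error: "\<bar>v k $ i $ c - X k $ c\<bar> \<le> n k $ c" for k i c
  proof -
    let ?B = "out_nbrs Eo (own c)"
    have few: "\<forall>i\<in>T. card (in_nbrs Ec i \<inter> A) \<le> D" using A2 by blast
    have "information_robust Ec Eo (2 * D + 1) (own c)" "own c \<in> ?B"
      using A4 assms(3) by (auto simp: out_nbrs_def)
    then obtain l :: "'a \<Rightarrow> nat" where l: "\<And>i. l i = 0 \<longleftrightarrow> i \<in> ?B" "\<And>i. l i \<le> ?K"
      "\<And>i. i \<in> T \<Longrightarrow> i \<notin> ?B \<Longrightarrow> D < card (in_nbrs Ec i \<inter> {j \<in> T. l j < l i})"
      "\<And>i j. i \<in> A \<Longrightarrow> i \<notin> ?B \<Longrightarrow> j \<in> T \<Longrightarrow> l j < l i"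
      using truthful_levels[OF assms(1,2) few] by blast
    have step: "\<bar>v k $ i $ c - X k $ c\<bar> \<le> \<omega> (l i) * (\<rho> * r + \<beta> / \<theta>)"
      if err: "\<And>j. \<bar>x k $ j $ c - X k $ c\<bar> \<le> \<omega> (l j) * r + \<beta>" and "0 \<le> r" "0 \<le> \<beta>" for k i r \<beta>
    proof (rule intermediate_estimate_error[OF assms(1,2,4,5) few l \<omega>(1-4) \<rho>\<theta>(3) \<omega>(5),
        where xs = "\<lambda>j. x k $ j $ c" and vs = "\<lambda>j. v k $ j $ c" and ys = "\<lambda>i j. y k i j $ c"])
      show "v k $ i $ c = X k $ c" if "i \<in> ?B" for i
        using observed[of c i k] that by (simp add: X_def in_nbrs_def out_nbrs_def)
      show "trimmed_average D \<eta> (in_nbrs Ec i) i (\<lambda>j. y k i j $ c) (v k $ i $ c)"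
        if "i \<in> T" "i \<notin> ?B" for i
        using assms(12) that unfolding truthful_dynamics_def
        by (metis in_nbrs_def mem_Collect_eq out_nbrs_def)
      show "supported_average \<eta> (in_nbrs Ec i \<inter> T) (\<lambda>j. x k $ j $ c) (v k $ i $ c)"
        if "i \<in> A" "i \<notin> ?B" for i
        using A3 that unfolding adversarial_dynamics_def
        by (metis in_nbrs_def mem_Collect_eq out_nbrs_def)
      show "y k i j $ c = x k $ j $ c" if "j \<in> insert i (in_nbrs Ec i \<inter> T)" for i j
        using assms(11) that unfolding messages_def by auto
    qed (use that in auto)
    have "\<bar>v k $ i $ c - X k $ c\<bar> \<le> \<omega> (l i) * n k $ c" for i
    proof (induction k arbitrary: i)
      case 0
      show ?case using step[of 0 0 b0 i] x0 b0 by (simp add: n_0)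
    next
      case (Suc k)
      \<comment> \<open>Agents other than the owner keep their intermediate estimate while the true
        coordinate moves by \<open>\<alpha> * g k $ c\<close>; the owner's entry is the true action
        itself.\<close>
      have "\<bar>x (Suc k) $ j $ c - X (Suc k) $ c\<bar> \<le> \<omega> (l j) * n k $ c + \<alpha> * \<bar>g k $ c\<bar>" for j
      proof (cases "j = own c")
        case True
        then have "l j = 0" using l(1)[of j] \<open>own c \<in> ?B\<close> by simp
        then show ?thesis using True \<alpha> by (simp add: x_Suc \<omega>(1))
      next
        case False
        then have "x (Suc k) $ j $ c - X (Suc k) $ c = (v k $ j $ c - X k $ c) + \<alpha> * g k $ c"
          by (simp add: x_Suc X_Suc)
        then show ?thesis using Suc[of j] \<alpha> abs_triangle_ineq[of "v k $ j $ c - X k $ c" "\<alpha> * g k $ c"]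
          by (simp add: abs_mult)
      qed
      from step[OF this n_nonneg, of i] show ?case using \<alpha> by (simp add: n_Suc)
    qed
    then have "\<bar>v k $ i $ c - X k $ c\<bar> \<le> \<omega> (l i) * n k $ c" .
    also have "\<dots> \<le> n k $ c" using mult_right_mono[OF \<omega>(3)[OF l(2)] n_nonneg] by simp
    finally show ?thesis .
  qed

  \<comment> \<open>From estimation errors to the gradient error\<close>
  have total: "(\<Sum>i\<in>UNIV. (norm (v k $ i - X k))\<^sup>2) \<le> ?K * (norm (n k))\<^sup>2" for k
  proof -
    have "(\<Sum>i\<in>UNIV. (norm (v k $ i - X k))\<^sup>2) = (\<Sum>c\<in>UNIV. \<Sum>i\<in>UNIV. (v k $ i $ c - X k $ c)\<^sup>2)"
      by (simp add: norm_vec_squared sum.swap[of _ UNIV "UNIV :: 'c set"])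
    also have "\<dots> \<le> (\<Sum>c\<in>UNIV. ?K * (n k $ c)\<^sup>2)"
    proof (rule sum_mono)
      fix c
      \<comment> \<open>The owner's entry is exact, hence the factor \<open>CARD('a) - 1\<close>
        instead of \<open>CARD('a)\<close>.\<close>
      have "(\<Sum>i\<in>UNIV. (v k $ i $ c - X k $ c)\<^sup>2) = (\<Sum>i\<in>UNIV - {own c}. (v k $ i $ c - X k $ c)\<^sup>2)"
        by (intro sum.mono_neutral_right) (auto simp: vX)
      also have "\<dots> \<le> (\<Sum>i\<in>UNIV - {own c}. (n k $ c)\<^sup>2)"
        using error n_nonneg by (intro sum_mono) (metis abs_le_square_iff abs_of_nonneg)
      finally show "(\<Sum>i\<in>UNIV. (v k $ i $ c - X k $ c)\<^sup>2) \<le> ?K * (n k $ c)\<^sup>2"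
        by (simp add: card_Diff_singleton)
    qed
    also have "\<dots> = ?K * (norm (n k))\<^sup>2" by (simp add: norm_vec_squared sum_distrib_left)
    finally show ?thesis .
  qed
  have gradient_error: "(norm (g k - ?F (X k)))\<^sup>2 \<le> L\<^sup>2 * (?K * (norm (n k))\<^sup>2)" for k
  proof -
    have "(norm (g k - ?F (X k)))\<^sup>2 = (\<Sum>c\<in>UNIV. (?F (v k $ own c) $ c - ?F (X k) $ c)\<^sup>2)"
      by (simp add: norm_vec_squared g_def)
    \<comment> \<open>Grouping by owner gives a single evaluation point \<open>v k $ i\<close> per
      group, where the Lipschitz bound can be used.\<close>
    also have "\<dots> = (\<Sum>i\<in>UNIV. \<Sum>c | own c = i. (?F (v k $ i) $ c - ?F (X k) $ c)\<^sup>2)"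
      by (subst sum.group[of UNIV UNIV own, symmetric]) (auto intro!: sum.cong)
    also have "\<dots> \<le> (\<Sum>i\<in>UNIV. L\<^sup>2 * (norm (v k $ i - X k))\<^sup>2)"
    proof (rule sum_mono)
      fix i
      have "(\<Sum>c | own c = i. (?F (v k $ i) $ c - ?F (X k) $ c)\<^sup>2) \<le>
          (\<Sum>c\<in>UNIV. (?F (v k $ i) $ c - ?F (X k) $ c)\<^sup>2)"
        by (intro sum_mono2) auto
      also have "\<dots> = (norm (?F (v k $ i) - ?F (X k)))\<^sup>2"
        by (simp add: norm_vec_squared)
      also have "\<dots> \<le> (L * norm (v k $ i - X k))\<^sup>2"
        using lipschitz_onD[OF game(2)] by (intro power_mono) (auto simp: dist_norm)
      finally show "(\<Sum>c | own c = i. (?F (v k $ i) $ c - ?F (X k) $ c)\<^sup>2) \<le>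
          L\<^sup>2 * (norm (v k $ i - X k))\<^sup>2" by (simp add: power_mult_distrib)
    qed
    also have "\<dots> \<le> L\<^sup>2 * (?K * (norm (n k))\<^sup>2)"
      using total by (simp add: mult_left_mono flip: sum_distrib_left)
    finally show ?thesis .
  qed

  \<comment> \<open>Decrease of the Lyapunov function and convergence\<close>
  define V where "V k = (norm (X k - xstar))\<^sup>2 + ?K / (1 - \<rho>\<^sup>2) * (norm (n k))\<^sup>2" for k
  define f where "f k = (norm (X k - xstar))\<^sup>2 + (sqrt ?K * norm (n k))\<^sup>2" for k
  have "f \<longlonglongrightarrow> 0"
  proof (rule nonneg_decrease_tendsto_zero[OF m, of V])
    show "0 \<le> V k" for k using \<rho>\<theta> by (simp add: V_def power_le_one)
    show "V (Suc k) \<le> V k - m * f k" for k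
      using lyapunov_decrease[OF game xstar \<alpha> gradient_error[of k] n_Suc[of k] \<rho>\<theta> K]
        form[of "norm (X k - xstar)" "sqrt ?K * norm (n k)"]
      unfolding V_def f_def X_Suc by linarith
  qed (simp add: f_def)
  then have sqrt_f: "(\<lambda>k. sqrt (f k)) \<longlonglongrightarrow> 0" using tendsto_real_sqrt by fastforce
  have vx: "norm (v k $ i - X k) \<le> sqrt (f k)" for k i
  proof (rule real_le_rsqrt)
    have "(norm (v k $ i - X k))\<^sup>2 \<le> (\<Sum>i\<in>UNIV. (norm (v k $ i - X k))\<^sup>2)"
      by (rule member_le_sum) auto
    also note total
    finally show "(norm (v k $ i - X k))\<^sup>2 \<le> f k" by (simp add: f_def power_mult_distrib add_increasing)
  qed
  have Xx: "norm (X k - xstar) \<le> sqrt (f k)" for k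
    by (rule real_le_rsqrt) (simp add: f_def)
  have X_lim: "X \<longlonglongrightarrow> xstar"
    by (rule LIM_zero_cancel, rule Lim_null_comparison[OF _ sqrt_f]) (simp add: Xx)
  have v_lim: "(\<lambda>k. v k $ i) \<longlonglongrightarrow> xstar" for i
  proof -
    have "(\<lambda>k. v k $ i - X k) \<longlonglongrightarrow> 0"
      by (rule Lim_null_comparison[OF _ sqrt_f]) (simp add: vx)
    from tendsto_add[OF this X_lim] show ?thesis by simp
  qed
  have "x \<longlonglongrightarrow> (\<chi> i. xstar)"
  proof (intro vec_tendstoI)
    fix i c
    \<comment> \<open>Only the estimates after a step are expressed by \<open>v\<close> and
      \<open>X\<close>, so the limit is taken along the shifted sequence.\<close>
    have "(\<lambda>k. x (Suc k) $ i $ c) \<longlonglongrightarrow> xstar $ c"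
      using tendsto_vec_nth[OF v_lim, of i c] tendsto_vec_nth[OF LIMSEQ_Suc[OF X_lim], of c]
      by (cases "i = own c") (simp_all add: x_Suc)
    from LIMSEQ_imp_Suc[OF this] show "(\<lambda>k. x k $ i $ c) \<longlonglongrightarrow> (\<chi> i. xstar) $ i $ c"
      by simp
  qed
  then show ?thesis
    using nash xstar strongly_monotone_zero_unique[OF game(1) xstar] by blast
qed

end
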